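(* For every joint distribution $(X,Z)$ on $\mathcal{X}\times\{0,1\}^{\lambda}$ and all parameters $\epsilon>0$ and $s$, there exists a (randomized) simulator $\mathsf{h}:\mathcal{X}\rightarrow \{0,1\}^{\lambda}$ such that (a) the distributions $(X,\mathsf{h}(X))$ and $(X,Z)$ are $(s,\epsilon)$-indistinguishable, and (b) $\mathsf{h}$ has complexity $s_{\mathsf{h}} = O\!\left(s\cdot 2^{2\lambda}\epsilon^{-4}\right)$.
   Context: Two distributions $Y_1,Y_2$ on the same domain are $(s,\epsilon)$-indistinguishable if for every distinguisher $\textsc{D}$ (a circuit) of size at most $s$, $\left|\Pr[\textsc{D}(Y_1)=1]-\Pr[\textsc{D}(Y_2)=1]\right|\leqslant \epsilon$. The complexity of the simulator $\mathsf{h}$ is its size as a (randomized) circuit. *)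

theory Defs
  imports "HOL-Probability.Probability"
begin

text \<open>A gate is either a constant or an arbitrary 2-input Boolean function
applied to two earlier wires.  Wires 0..k-1 carry the k inputs; the j-th gate
(0-based) drives wire k+j.\<close>

datatype gate = Const bool | Bin "bool \<Rightarrow> bool \<Rightarrow> bool" nat nat

datatype circuit = Circuit (c_inputs: nat) (c_gates: "gate list") (c_outputs: "nat list")

definition circuit_size :: "circuit \<Rightarrow> nat" where
  "circuit_size C = length (c_gates C)"

fun gate_ok :: "nat \<Rightarrow> gate \<Rightarrow> bool" where
  "gate_ok m (Const b) = True"
| "gate_ok m (Bin f a b) = (a < m \<and> b < m)"

definition wf_circuit :: "circuit \<Rightarrow> nat \<Rightarrow> nat \<Rightarrow> bool" where
  "wf_circuit C k out \<longleftrightarrow>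
     c_inputs C = k \<and> length (c_outputs C) = out \<and>
     (\<forall>j < length (c_gates C). gate_ok (k + j) (c_gates C ! j)) \<and>
     (\<forall>w \<in> set (c_outputs C). w < k + length (c_gates C))"

fun gate_val :: "bool list \<Rightarrow> gate \<Rightarrow> bool" where
  "gate_val vs (Const b) = b"
| "gate_val vs (Bin f a b) = f (vs ! a) (vs ! b)"

definition wire_values :: "circuit \<Rightarrow> bool list \<Rightarrow> bool list" where
  "wire_values C inp = foldl (\<lambda>vs g. vs @ [gate_val vs g]) inp (c_gates C)"

definition eval_circuit :: "circuit \<Rightarrow> bool list \<Rightarrow> bool list" where
  "eval_circuit C inp = map (\<lambda>w. wire_values C inp ! w) (c_outputs C)"

text \<open>A distinguisher for distributions on pairs (x,z) with |x| = n, |z| = l is a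
circuit with n+l inputs and a single output bit, fed with x @ z.\<close>

definition accept_prob :: "circuit \<Rightarrow> (bool list \<times> bool list) pmf \<Rightarrow> real" where
  "accept_prob D Y = measure_pmf.prob Y {(x, z). eval_circuit D (x @ z) = [True]}"

definition indist :: "nat \<Rightarrow> nat \<Rightarrow> nat \<Rightarrow> real \<Rightarrow>
    (bool list \<times> bool list) pmf \<Rightarrow> (bool list \<times> bool list) pmf \<Rightarrow> bool" where
  "indist n l s \<epsilon> Y1 Y2 \<longleftrightarrow>
     (\<forall>D. wf_circuit D (n + l) 1 \<and> circuit_size D \<le> s \<longrightarrow>
          \<bar>accept_prob D Y1 - accept_prob D Y2\<bar> \<le> \<epsilon>)"

text \<open>A randomized circuit computing a map {0,1}^n -> {0,1}^l: a circuit with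
n + r inputs (the last r being uniformly random bits) and l outputs.\<close>

definition uniform_bits :: "nat \<Rightarrow> bool list pmf" where
  "uniform_bits r = pmf_of_set {\<rho>. length \<rho> = r}"

definition rand_eval :: "circuit \<Rightarrow> nat \<Rightarrow> bool list \<Rightarrow> bool list pmf" where
  "rand_eval C r x = map_pmf (\<lambda>\<rho>. eval_circuit C (x @ \<rho>)) (uniform_bits r)"

definition sim_joint :: "circuit \<Rightarrow> nat \<Rightarrow> (bool list \<times> bool list) pmf \<Rightarrow>
    (bool list \<times> bool list) pmf" where
  "sim_joint C r XZ = bind_pmf XZ (\<lambda>(x, _). map_pmf (\<lambda>y. (x, y)) (rand_eval C r x))"

end

theory Submission
  imports Defs
begin

text \<open>
  The simulator plays follow-the-perturbed-leader against the distinguishers. Given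
  distinguishers \<open>D\<^sub>1, \<dots>, D\<^sub>t\<close> (each possibly negated), it counts for every candidate \<open>z\<close> how many
  of them accept \<open>(x, z)\<close>, adds independent geometric noise to each count and outputs the first
  \<open>z\<close> with the largest total. If this fails to fool some \<open>D\<close> (possibly negated) with advantage
  \<open>\<epsilon>\<close>, then \<open>D\<close> becomes \<open>D\<^sub>t\<^sub>+\<^sub>1\<close>. For every fixed \<open>(x, z)\<close> the regret of the perturbed leader is
  at most \<open>\<epsilon> T\<close> once \<open>T\<close> is of order \<open>\<lambda> / \<epsilon>\<^sup>2\<close>; averaging over \<open>(X, Z)\<close>
  shows that the process stops within \<open>T\<close> rounds.

  The noise is the number of initial successes of coins with bias \<open>1 - 2\<^bsup>-k\<^esup>\<close>, where \<open>2\<^bsup>-k\<^esup>\<close> is of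
  order \<open>\<epsilon>\<close>, which a circuit obtains from uniform bits by disjunctions of \<open>k\<close> bits. The counts are
  kept in unary, so that all rounds together cost \<open>O(2\<^bsup>\<lambda>\<^esup> T (s + T))\<close> gates, and
  \<open>\<lambda>\<^sup>2 2\<^bsup>\<lambda>\<^esup> = O(2\<^bsup>2\<lambda>\<^esup>)\<close> absorbs the factor \<open>\<lambda>\<^sup>2\<close> in \<open>T\<^sup>2\<close>.
\<close>

section \<open>A cost calculus for circuits\<close>

definition vals :: "gate list \<Rightarrow> bool list \<Rightarrow> bool list" where
  "vals gs inp = foldl (\<lambda>vs g. vs @ [gate_val vs g]) inp gs"

definition gates_ok :: "nat \<Rightarrow> gate list \<Rightarrow> bool" where
  "gates_ok k gs \<longleftrightarrow> (\<forall>j < length gs. gate_ok (k + j) (gs ! j))"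

text \<open>Only inputs of length \<open>k\<close> constrain \<open>\<phi>\<close>, so a function
  may later be exchanged for any other that agrees with it on those inputs.\<close>

definition avail :: "nat \<Rightarrow> gate list \<Rightarrow> (bool list \<Rightarrow> bool) set" where
  "avail k gs = {\<phi>. \<exists>w < k + length gs. \<forall>inp. length inp = k \<longrightarrow> vals gs inp ! w = \<phi> inp}"

text \<open>Only the functions carried by wires are tracked, not the wire positions: starting from any
  gate list providing \<open>A\<close>, at most \<open>c\<close> further gates provide \<open>B\<close>.\<close>

definition synth ::
  "nat \<Rightarrow> (bool list \<Rightarrow> bool) set \<Rightarrow> nat \<Rightarrow> (bool list \<Rightarrow> bool) set \<Rightarrow> bool" where
  "synth k A c B \<longleftrightarrow> (\<forall>gs. gates_ok k gs \<and> A \<subseteq> avail k gs \<longrightarrow>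
     (\<exists>gs'. gates_ok k (gs @ gs') \<and> length gs' \<le> c \<and> B \<subseteq> avail k (gs @ gs')))"

lemma vals_snoc [simp]: "vals (gs @ [g]) inp = vals gs inp @ [gate_val (vals gs inp) g]"
  by (simp add: vals_def)

lemma vals_Nil [simp]: "vals [] inp = inp"
  by (simp add: vals_def)

lemma length_vals [simp]: "length (vals gs inp) = length inp + length gs"
  by (induction gs rule: rev_induct) simp_all

lemma nth_vals_append:
  assumes "w < length inp + length gs"
  shows "vals (gs @ gs') inp ! w = vals gs inp ! w"
proof (induction gs' rule: rev_induct)
  case (snoc g gs')
  have "vals (gs @ gs' @ [g]) inp = vals (gs @ gs') inp @ [gate_val (vals (gs @ gs') inp) g]"
    using vals_snoc [of "gs @ gs'"] by simp
  with snoc assms show ?case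
    by (simp add: nth_append)
qed simp

lemma gates_ok_snoc:
  "gates_ok k (gs @ [g]) \<longleftrightarrow> gates_ok k gs \<and> gate_ok (k + length gs) g"
  by (auto simp: gates_ok_def nth_append less_Suc_eq)

lemma avail_append: "avail k gs \<subseteq> avail k (gs @ gs')"
proof
  fix \<phi> assume "\<phi> \<in> avail k gs"
  then obtain w where "w < k + length gs" "\<forall>inp. length inp = k \<longrightarrow> vals gs inp ! w = \<phi> inp"
    by (auto simp: avail_def)
  then show "\<phi> \<in> avail k (gs @ gs')"
    unfolding avail_def by (auto simp: nth_vals_append intro!: exI [of _ w])
qed

lemma synth_mono:
  assumes "synth k A c B" "A \<subseteq> A'" "c \<le> c'" "B' \<subseteq> B"
  shows "synth k A' c' B'"
  using assms unfolding synth_def by (meson dual_order.trans)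

lemma synth_subset: "B \<subseteq> A \<Longrightarrow> synth k A c B"
  unfolding synth_def by (auto intro!: exI [of _ "[]"])

text \<open>Since \<open>synth\<close> speaks of every starting list, the second synthesis may run
  on the list that the first has extended, whose old wires keep their values.\<close>

lemma synth_trans:
  assumes AB: "synth k A c B" and BC: "synth k (A \<union> B) d C"
  shows "synth k A (c + d) (B \<union> C)"
  unfolding synth_def
proof (intro allI impI)
  fix gs assume gs: "gates_ok k gs \<and> A \<subseteq> avail k gs"
  with AB obtain hs where hs: "gates_ok k (gs @ hs)" "length hs \<le> c" "B \<subseteq> avail k (gs @ hs)"
    unfolding synth_def by blast
  have "A \<union> B \<subseteq> avail k (gs @ hs)"
    using gs hs(3) avail_append [of k gs hs] by blast
  with BC hs(1) obtain ks where ks: "gates_ok k ((gs @ hs) @ ks)" "length ks \<le> d"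
      "C \<subseteq> avail k ((gs @ hs) @ ks)"
    unfolding synth_def by blast
  have "B \<subseteq> avail k ((gs @ hs) @ ks)"
    using hs(3) avail_append [of k "gs @ hs" ks] by blast
  with hs ks show "\<exists>gs'. gates_ok k (gs @ gs') \<and> length gs' \<le> c + d \<and> B \<union> C \<subseteq> avail k (gs @ gs')"
    by (intro exI [of _ "hs @ ks"]) auto
qed

lemma synth_UN:
  assumes "finite I" "\<And>i. i \<in> I \<Longrightarrow> synth k A c (B i)"
  shows "synth k A (card I * c) (\<Union>i\<in>I. B i)"
  using assms
proof (induction I rule: finite_induct)
  case empty
  show ?case by (simp add: synth_subset)
next
  case (insert i I)
  have "synth k A (c + card I * c) (B i \<union> (\<Union>i\<in>I. B i))"
    by (rule synth_trans [OF insert.prems])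
      (use insert in \<open>auto intro: synth_mono [OF insert.IH]\<close>)
  with insert.hyps show ?case by simp
qed

lemma synth_image:
  assumes "finite I" "\<And>i. i \<in> I \<Longrightarrow> synth k A c {\<phi> i}"
  shows "synth k A (card I * c) (\<phi> ` I)"
proof -
  have "(\<Union>i\<in>I. {\<phi> i}) = \<phi> ` I" by auto
  with synth_UN [where B = "\<lambda>i. {\<phi> i}", OF assms] show ?thesis by simp
qed

lemma synth_cong_set:
  assumes "synth k A c B"
    and "\<And>\<psi>. \<psi> \<in> B' \<Longrightarrow> \<exists>\<phi>\<in>B. \<forall>inp. length inp = k \<longrightarrow> \<phi> inp = \<psi> inp"
  shows "synth k A c B'"
proof -
  have "B' \<subseteq> avail k gs" if "B \<subseteq> avail k gs" for gs
  proof
    fix \<psi> assume "\<psi> \<in> B'"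
    with assms(2) obtain \<phi> where \<phi>: "\<phi> \<in> B" "\<And>inp. length inp = k \<Longrightarrow> \<phi> inp = \<psi> inp"
      by blast
    with that have "\<phi> \<in> avail k gs" by blast
    with \<phi>(2) show "\<psi> \<in> avail k gs" by (auto simp: avail_def)
  qed
  with assms(1) show ?thesis unfolding synth_def by meson
qed

lemma synth_cong:
  assumes "synth k A c {\<phi>}" "\<And>inp. length inp = k \<Longrightarrow> \<phi> inp = \<psi> inp"
  shows "synth k A c {\<psi>}"
  using assms by (auto intro: synth_cong_set)

lemma synth_const: "synth k A 1 {\<lambda>_. b}"
  unfolding synth_def
proof (intro allI impI)
  fix gs assume "gates_ok k gs \<and> A \<subseteq> avail k gs"
  then show "\<exists>gs'. gates_ok k (gs @ gs') \<and> length gs' \<le> 1 \<and> {\<lambda>_. b} \<subseteq> avail k (gs @ gs')"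
    by (intro exI [of _ "[Const b]"])
      (auto simp: gates_ok_snoc avail_def nth_append intro!: exI [of _ "k + length gs"])
qed

lemma synth_gate:
  assumes "\<phi> \<in> A" "\<psi> \<in> A"
  shows "synth k A 1 {\<lambda>inp. f (\<phi> inp) (\<psi> inp)}"
  unfolding synth_def
proof (intro allI impI)
  fix gs assume gs: "gates_ok k gs \<and> A \<subseteq> avail k gs"
  with assms have "\<phi> \<in> avail k gs" "\<psi> \<in> avail k gs" by auto
  then obtain a b where
      a: "a < k + length gs" "\<And>inp. length inp = k \<Longrightarrow> vals gs inp ! a = \<phi> inp" and
      b: "b < k + length gs" "\<And>inp. length inp = k \<Longrightarrow> vals gs inp ! b = \<psi> inp"
    unfolding avail_def by blast
  with gs show "\<exists>gs'. gates_ok k (gs @ gs') \<and> length gs' \<le> 1 \<and>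
      {\<lambda>inp. f (\<phi> inp) (\<psi> inp)} \<subseteq> avail k (gs @ gs')"
    by (intro exI [of _ "[Bin f a b]"])
      (auto simp: gates_ok_snoc avail_def nth_append intro!: exI [of _ "k + length gs"])
qed

text \<open>A chain of \<open>m\<close> disjunctions; the additional gate is the constant
  \<open>False\<close> at its start.\<close>

lemma synth_Ex_less:
  assumes "\<And>i. i < m \<Longrightarrow> \<phi> i \<in> A"
  shows "synth k A (m + 1) {\<lambda>inp. \<exists>i<m. \<phi> i inp}"
  using assms
proof (induction m)
  case 0
  show ?case using synth_const [of k A False] by simp
next
  case (Suc m)
  have "synth k A ((m + 1) + 1) ({\<lambda>inp. \<exists>i<m. \<phi> i inp} \<union> {\<lambda>inp. (\<exists>i<m. \<phi> i inp) \<or> \<phi> m inp})"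
    by (rule synth_trans [OF Suc.IH])
      (use Suc.prems in \<open>auto intro!: synth_gate [where f = "(\<or>)", simplified]\<close>)
  then have "synth k A (Suc m + 1) {\<lambda>inp. (\<exists>i<m. \<phi> i inp) \<or> \<phi> m inp}"
    by (rule synth_mono) auto
  then show ?case by (rule synth_cong) (auto simp: less_Suc_eq)
qed

text \<open>Inlining: each gate of \<open>ds\<close> is copied once, with the functions
  \<open>\<phi>s\<close> in place of its inputs. The induction keeps all wires, since a later gate
  may read any of them.\<close>

lemma synth_wires:
  assumes "gates_ok (length \<phi>s) ds" "set \<phi>s \<subseteq> A"
  shows "synth k A (length ds)
    ((\<lambda>w inp. vals ds (map (\<lambda>\<phi>. \<phi> inp) \<phi>s) ! w) ` {..<length \<phi>s + length ds})"
    (is "synth k A _ (?W ds ` _)")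
  using assms(1)
proof (induction ds rule: rev_induct)
  case Nil
  have "?W [] w \<in> A" if "w < length \<phi>s" for w
  proof -
    have "?W [] w = \<phi>s ! w" using that by (simp add: fun_eq_iff)
    with that assms(2) show ?thesis by (metis nth_mem subsetD)
  qed
  then show ?case by (intro synth_subset) auto
next
  case (snoc g ds)
  let ?m = "length \<phi>s + length ds"
  have ok: "gates_ok (length \<phi>s) ds" "gate_ok ?m g"
    using snoc.prems by (auto simp: gates_ok_snoc)
  have new: "synth k (A \<union> ?W ds ` {..<?m}) 1 {?W (ds @ [g]) ?m}"
  proof (cases g)
    case (Const b)
    then have "?W (ds @ [g]) ?m = (\<lambda>_. b)" by (simp add: fun_eq_iff nth_append)
    then show ?thesis by (simp add: synth_const del: One_nat_def)
  next
    case (Bin f a b)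
    then have "?W (ds @ [g]) ?m = (\<lambda>inp. f (?W ds a inp) (?W ds b inp))"
      by (simp add: fun_eq_iff nth_append)
    moreover have "a < ?m" "b < ?m" using ok Bin by auto
    ultimately show ?thesis
      using synth_gate [of "?W ds a" "A \<union> ?W ds ` {..<?m}" "?W ds b" k f] by simp
  qed
  have old: "?W (ds @ [g]) w = ?W ds w" if "w < ?m" for w
    using that by (simp add: fun_eq_iff nth_append)
  have "?W (ds @ [g]) ` {..<length \<phi>s + length (ds @ [g])} =
      ?W ds ` {..<?m} \<union> {?W (ds @ [g]) ?m}"
    using old by (auto simp: lessThan_Suc image_iff)
  with synth_trans [OF snoc.IH [OF ok(1)] new] show ?case by simp
qed

lemma synth_circuit:
  assumes "wf_circuit D (length \<phi>s) 1" "set \<phi>s \<subseteq> A"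
  shows "synth k A (circuit_size D) {\<lambda>inp. eval_circuit D (map (\<lambda>\<phi>. \<phi> inp) \<phi>s) = [True]}"
proof -
  obtain w where w: "c_outputs D = [w]"
    using assms(1) by (auto simp: wf_circuit_def length_Suc_conv)
  have "w < length \<phi>s + length (c_gates D)"
    using assms(1) w by (auto simp: wf_circuit_def)
  moreover have "gates_ok (length \<phi>s) (c_gates D)"
    using assms(1) by (auto simp: wf_circuit_def gates_ok_def)
  ultimately have "synth k A (circuit_size D)
      {\<lambda>inp. vals (c_gates D) (map (\<lambda>\<phi>. \<phi> inp) \<phi>s) ! w}"
    using synth_wires [of \<phi>s "c_gates D" A k] assms(2) unfolding circuit_size_def
    by (auto elim: synth_mono)
  then show ?thesis
    by (rule synth_cong) (simp add: eval_circuit_def w wire_values_def vals_def)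
qed

text \<open>The projections are the wires of the empty gate list, so a synthesis that starts from
  them yields a complete circuit.\<close>

lemma circuit_of_synth:
  assumes "synth k ((\<lambda>i inp. inp ! i) ` {..<k}) c (\<phi> ` {..<out})"
  obtains C where "wf_circuit C k out" "circuit_size C \<le> c"
    "\<And>inp. length inp = k \<Longrightarrow> eval_circuit C inp = map (\<lambda>b. \<phi> b inp) [0..<out]"
proof -
  have "(\<lambda>i inp. inp ! i) ` {..<k} \<subseteq> avail k []"
    by (auto simp: avail_def)
  with assms obtain gs where gs: "gates_ok k gs" "length gs \<le> c" "\<phi> ` {..<out} \<subseteq> avail k gs"
    unfolding synth_def gates_ok_def by (metis append_Nil length_0_conv not_less_zero list.size(3))
  then have "\<forall>b\<in>{..<out}. \<exists>w < k + length gs. \<forall>inp. length inp = k \<longrightarrow> vals gs inp ! w = \<phi> b inp"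
    by (auto simp: avail_def)
  then obtain W where W: "\<And>b. b < out \<Longrightarrow> W b < k + length gs"
      "\<And>b inp. b < out \<Longrightarrow> length inp = k \<Longrightarrow> vals gs inp ! W b = \<phi> b inp"
    by (metis lessThan_iff)
  show thesis
  proof
    show "wf_circuit (Circuit k gs (map W [0..<out])) k out"
      using gs(1) W(1) by (auto simp: wf_circuit_def gates_ok_def)
  qed (use gs W(2) in \<open>auto simp: circuit_size_def eval_circuit_def wire_values_def vals_def\<close>)
qed

section \<open>Regret of the perturbed leader\<close>

text \<open>The argmax of \<open>S\<close> on \<open>{..m}\<close>; the strict comparison resolves
  ties in favour of the smallest index.\<close>

fun lead :: "(nat \<Rightarrow> nat) \<Rightarrow> nat \<Rightarrow> nat" where
  "lead S 0 = 0"
| "lead S (Suc m) = (if S (lead S m) < S (Suc m) then Suc m else lead S m)"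

lemma lead_props:
  "lead S m \<le> m \<and> (\<forall>j\<le>m. S j \<le> S (lead S m)) \<and> (\<forall>j<lead S m. S j < S (lead S m))"
proof (induction m)
  case (Suc m)
  show ?case
  proof (cases "S (lead S m) < S (Suc m)")
    case True
    then have "S j < S (Suc m)" if "j \<le> m" for j
      using Suc that by (meson le_less_trans)
    with True show ?thesis by (auto simp: le_Suc_eq less_Suc_eq_le less_imp_le)
  next
    case False
    with Suc show ?thesis by (auto simp: le_Suc_eq)
  qed
qed simp

lemmas lead_le = lead_props [THEN conjunct1]
lemmas lead_max = lead_props [THEN conjunct2, THEN conjunct1, rule_format]

lemma lead_eq_iff: "lead S m = i \<longleftrightarrow> i \<le> m \<and> (\<forall>j\<le>m. S j \<le> S i) \<and> (\<forall>j<i. S j < S i)"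
proof
  assume "i \<le> m \<and> (\<forall>j\<le>m. S j \<le> S i) \<and> (\<forall>j<i. S j < S i)"
  then show "lead S m = i"
    using lead_props [of S m] by (metis leD linorder_neqE_nat)
qed (use lead_props in blast)

text \<open>Both comparisons in \<open>lead_eq_iff\<close> survive when the leader rises and the
  others fall. This converts a gained point into a unit of noise below.\<close>

lemma lead_raise:
  assumes "lead S m = i" "S i \<le> S' i" "\<And>j. j \<noteq> i \<Longrightarrow> S' j \<le> S j"
  shows "lead S' m = i"
proof -
  have S: "i \<le> m" "\<And>j. j \<le> m \<Longrightarrow> S j \<le> S i" "\<And>j. j < i \<Longrightarrow> S j < S i"
    using assms(1) unfolding lead_eq_iff by auto
  have "S' j \<le> S' i" if "j \<le> m" for j
    using S(2) [OF that] assms(2) assms(3) [of j] by (cases "j = i") auto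
  moreover have "S' j < S' i" if "j < i" for j
    using S(3) [OF that] assms(2) assms(3) [of j] that by simp
  ultimately show ?thesis using S(1) unfolding lead_eq_iff by blast
qed

section \<open>Truncated geometric noise\<close>

text \<open>Counts the successes before the first failure among at most \<open>B\<close> tosses of
  bias \<open>q\<close>. The cap bounds the number of coins that a circuit has to toss.\<close>

fun trunc_geom :: "real \<Rightarrow> nat \<Rightarrow> nat pmf" where
  "trunc_geom q 0 = return_pmf 0"
| "trunc_geom q (Suc B) =
     bernoulli_pmf q \<bind> (\<lambda>b. if b then map_pmf Suc (trunc_geom q B) else return_pmf 0)"

lemma finite_trunc_geom [simp]: "finite (set_pmf (trunc_geom q B))"
  by (induction B) auto

lemma expectation_bind_finite:
  fixes h :: "'b \<Rightarrow> real"
  assumes "finite (set_pmf p)" "\<And>x. x \<in> set_pmf p \<Longrightarrow> finite (set_pmf (f x))"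
  shows "measure_pmf.expectation (p \<bind> f) h =
    measure_pmf.expectation p (\<lambda>x. measure_pmf.expectation (f x) h)"
  using assms
  by (subst pmf_expectation_bind [of "set_pmf p"]) (auto simp: integral_measure_pmf [of "set_pmf p"])

lemma expectation_mono_finite:
  fixes g h :: "'b \<Rightarrow> real"
  assumes "finite (set_pmf p)" "\<And>x. x \<in> set_pmf p \<Longrightarrow> g x \<le> h x"
  shows "measure_pmf.expectation p g \<le> measure_pmf.expectation p h"
  using assms
  by (auto intro!: integral_mono_AE integrable_measure_pmf_finite simp: AE_measure_pmf_iff)

lemma expectation_trunc_geom_Suc:
  fixes h :: "nat \<Rightarrow> real"
  assumes "0 \<le> q" "q \<le> 1"
  shows "measure_pmf.expectation (trunc_geom q (Suc B)) h =
    (1 - q) * h 0 + q * measure_pmf.expectation (trunc_geom q B) (\<lambda>g. h (Suc g))"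
  using assms by (simp add: expectation_bind_finite)

text \<open>On the same tosses the two caps give different values only if all \<open>Suc B\<close>
  tosses succeed, an event of mass \<open>q ^ Suc B\<close>. The induction peels off the first
  toss.\<close>

lemma expectation_trunc_geom_extend:
  fixes h :: "nat \<Rightarrow> real"
  assumes q: "0 \<le> q" "q \<le> 1" and "\<And>g. 0 \<le> h g" "\<And>g. h g \<le> 1"
  shows "measure_pmf.expectation (trunc_geom q (Suc B)) h \<le>
    measure_pmf.expectation (trunc_geom q B) h + q ^ Suc B"
  using assms(3,4)
proof (induction B arbitrary: h)
  case 0
  have "(1 - q) * h 0 \<le> h 0" "q * h 1 \<le> q"
    using q 0 by (auto intro: mult_left_le_one_le mult_left_le)
  then show ?case using q by (simp add: expectation_trunc_geom_Suc del: trunc_geom.simps(2))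
next
  case (Suc B)
  have "measure_pmf.expectation (trunc_geom q (Suc B)) (\<lambda>g. h (Suc g)) \<le>
      measure_pmf.expectation (trunc_geom q B) (\<lambda>g. h (Suc g)) + q ^ Suc B"
    by (rule Suc.IH) (use Suc.prems in auto)
  from mult_left_mono [OF this q(1)] show ?case
    unfolding expectation_trunc_geom_Suc [OF q, of "Suc B"]
    using q by (simp add: expectation_trunc_geom_Suc algebra_simps del: trunc_geom.simps(2))
qed

text \<open>Memorylessness: shifting the noise by one costs a factor \<open>q\<close>, up to the mass at the truncation
  point.\<close>

lemma expectation_trunc_geom_shift:
  fixes h h' :: "nat \<Rightarrow> real"
  assumes q: "0 \<le> q" "q \<le> 1" and h: "\<And>g. 0 \<le> h g" "\<And>g. h g \<le> 1"
    and h': "\<And>g. 0 \<le> h' g" "\<And>g. h g \<le> h' (Suc g)"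
  shows "q * measure_pmf.expectation (trunc_geom q B) h \<le>
    measure_pmf.expectation (trunc_geom q B) h' + q ^ B"
proof (cases B)
  case 0
  have "q * h 0 \<le> 1" using q h by (simp add: mult_le_one)
  with h'(1) [of 0] show ?thesis using 0 by simp
next
  case (Suc B')
  \<comment> \<open>The cap is lowered to \<open>B'\<close> first, so that the shifted value
    \<open>Suc g\<close> still lies below the cap \<open>B\<close>.\<close>
  have "measure_pmf.expectation (trunc_geom q B) h \<le>
      measure_pmf.expectation (trunc_geom q B') h + q ^ B"
    using expectation_trunc_geom_extend [OF q, of h B'] h Suc by simp
  also have "measure_pmf.expectation (trunc_geom q B') h \<le>
      measure_pmf.expectation (trunc_geom q B') (\<lambda>g. h' (Suc g))"
    by (rule expectation_mono_finite) (auto simp: h')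
  finally have "q * measure_pmf.expectation (trunc_geom q B) h \<le>
      q * measure_pmf.expectation (trunc_geom q B') (\<lambda>g. h' (Suc g)) + q * q ^ B"
    using q(1) by (simp add: mult_left_mono flip: distrib_left)
  moreover have "q * q ^ B \<le> q ^ B" using q by (simp add: mult_left_le_one_le)
  moreover have "0 \<le> (1 - q) * h' 0" using q h' by simp
  ultimately show ?thesis
    unfolding Suc using expectation_trunc_geom_Suc [OF q, of B' h'] by simp
qed

text \<open>Natural subtraction makes \<open>g - M\<close> the excess over \<open>M\<close>.
  Reaching \<open>M\<close> has probability at most \<open>q ^ M\<close>, and the further successes
  have mean at most \<open>1 / (1 - q)\<close>. \<open>M\<close> varies in the induction because a
  success lowers the remaining threshold by one.\<close>

lemma expectation_trunc_geom_excess: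
  assumes q: "0 \<le> q" "q < 1"
  shows "measure_pmf.expectation (trunc_geom q B) (\<lambda>g. real (g - M)) \<le> q ^ M / (1 - q)"
proof (induction B arbitrary: M)
  case 0
  then show ?case using q by simp
next
  case (Suc B)
  let ?E = "measure_pmf.expectation (trunc_geom q B)"
  have eq: "measure_pmf.expectation (trunc_geom q (Suc B)) (\<lambda>g. real (g - M)) =
      q * ?E (\<lambda>g. real (Suc g - M))"
    using q by (subst expectation_trunc_geom_Suc) auto
  show ?case
  proof (cases M)
    case 0
    have "?E (\<lambda>g. real (Suc g - M)) = ?E (\<lambda>g. 1 + real (g - 0))"
      using 0 by (simp add: add.commute)
    also have "\<dots> = 1 + ?E (\<lambda>g. real (g - 0))"
      by (subst Bochner_Integration.integral_add) (auto intro: integrable_measure_pmf_finite)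
    also have "\<dots> \<le> 1 + 1 / (1 - q)" using Suc.IH [of 0] by simp
    finally have "q * ?E (\<lambda>g. real (Suc g - M)) \<le> q * (1 + 1 / (1 - q))"
      using q by (intro mult_left_mono) auto
    also have "\<dots> \<le> 1 / (1 - q)"
    proof -
      have "q * (1 + 1 / (1 - q)) = 1 / (1 - q) - (1 - q)"
        using q by (simp add: field_simps)
      with q show ?thesis by simp
    qed
    finally show ?thesis using eq 0 by simp
  next
    case (Suc M')
    have "q * ?E (\<lambda>g. real (Suc g - M)) \<le> q * (q ^ M' / (1 - q))"
      using Suc.IH [of M'] q Suc by (intro mult_left_mono) auto
    then show ?thesis using eq Suc by simp
  qed
qed

section \<open>Stability of the noisy leader\<close>

abbreviation noise :: "real \<Rightarrow> nat \<Rightarrow> nat \<Rightarrow> (nat \<Rightarrow> nat) pmf" where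
  "noise q B m \<equiv> Pi_pmf {..m} 0 (\<lambda>_. trunc_geom q B)"

lemma finite_noise [simp]: "finite (set_pmf (noise q B m))"
  by (rule finite_subset [OF set_Pi_pmf_subset']) auto

lemma integrable_noise [simp]: "integrable (measure_pmf (noise q B m)) (h :: _ \<Rightarrow> real)"
  by (simp add: integrable_measure_pmf_finite)

text \<open>By independence, coordinate \<open>i\<close> can be integrated first while all the
  others are frozen.\<close>

lemma expectation_noise_split:
  fixes h :: "(nat \<Rightarrow> nat) \<Rightarrow> real"
  assumes "i \<le> m"
  shows "measure_pmf.expectation (noise q B m) h =
    measure_pmf.expectation (Pi_pmf ({..m} - {i}) 0 (\<lambda>_. trunc_geom q B))
      (\<lambda>G. measure_pmf.expectation (trunc_geom q B) (\<lambda>g. h (G(i := g))))"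
proof -
  let ?R = "Pi_pmf ({..m} - {i}) 0 (\<lambda>_. trunc_geom q B)"
  have fin: "finite (set_pmf ?R)"
    by (rule finite_subset [OF set_Pi_pmf_subset']) auto
  have "{..m} = insert i ({..m} - {i})" using assms by auto
  then have "noise q B m = map_pmf (\<lambda>(g, G). G(i := g)) (pair_pmf (trunc_geom q B) ?R)"
    using Pi_pmf_insert [of "{..m} - {i}" i 0 "\<lambda>_. trunc_geom q B"] by simp
  also have "\<dots> = ?R \<bind> (\<lambda>G. map_pmf (\<lambda>g. G(i := g)) (trunc_geom q B))"
    by (subst pair_commute_pmf)
      (simp add: pair_pmf_def map_pmf_def bind_assoc_pmf bind_return_pmf)
  finally show ?thesis using fin by (simp add: expectation_bind_finite)
qed

text \<open>Freeze the noise of all candidates but \<open>i\<close>. If \<open>i\<close> leads with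
  the gains \<open>f\<close> included, then one more unit of noise on \<open>i\<close> lets it lead
  without them: its total does not drop and no other total rises. The shift of the noise by one
  costs the factor \<open>q\<close> and the error \<open>q ^ B\<close>.\<close>

lemma lead_stability:
  fixes c :: "nat \<Rightarrow> nat"
  assumes q: "0 \<le> q" "q \<le> 1" and i: "i \<le> m"
  shows "q * measure_pmf.expectation (noise q B m)
      (\<lambda>G. of_bool (lead (\<lambda>j. c j + of_bool (f j) + G j) m = i)) \<le>
    measure_pmf.expectation (noise q B m) (\<lambda>G. of_bool (lead (\<lambda>j. c j + G j) m = i)) + q ^ B"
proof -
  let ?R = "Pi_pmf ({..m} - {i}) 0 (\<lambda>_. trunc_geom q B)"
  let ?J = "\<lambda>G. of_bool (lead (\<lambda>j. c j + of_bool (f j) + G j) m = i) :: real"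
  let ?I = "\<lambda>G. of_bool (lead (\<lambda>j. c j + G j) m = i) :: real"
  have fin: "finite (set_pmf ?R)"
    by (rule finite_subset [OF set_Pi_pmf_subset']) auto
  have *: "q * measure_pmf.expectation (trunc_geom q B) (\<lambda>g. ?J (G(i := g))) \<le>
      measure_pmf.expectation (trunc_geom q B) (\<lambda>g. ?I (G(i := g))) + q ^ B" for G
  proof (rule expectation_trunc_geom_shift [OF q])
    fix g
    have "lead (\<lambda>j. c j + (G(i := Suc g)) j) m = i"
      if "lead (\<lambda>j. c j + of_bool (f j) + (G(i := g)) j) m = i"
      by (rule lead_raise [OF that]) auto
    then show "?J (G(i := g)) \<le> ?I (G(i := Suc g))" by auto
  qed auto
  have "q * measure_pmf.expectation (noise q B m) ?J =
      measure_pmf.expectation ?R (\<lambda>G. q * measure_pmf.expectation (trunc_geom q B) (\<lambda>g. ?J (G(i := g))))"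
    by (simp add: expectation_noise_split [OF i])
  also have "\<dots> \<le> measure_pmf.expectation ?R
      (\<lambda>G. measure_pmf.expectation (trunc_geom q B) (\<lambda>g. ?I (G(i := g))) + q ^ B)"
    using fin * by (rule expectation_mono_finite)
  also have "\<dots> = measure_pmf.expectation (noise q B m) ?I + q ^ B"
    by (subst Bochner_Integration.integral_add)
      (auto intro: integrable_measure_pmf_finite fin simp: expectation_noise_split [OF i])
  finally show ?thesis .
qed

text \<open>Summing \<open>lead_stability\<close> over the possible leaders: the losses
  \<open>(1 - q)\<close> are weighted by probabilities that add up to 1, while the truncation error
  is paid once per candidate.\<close>

lemma lead_gain_stability:
  fixes c :: "nat \<Rightarrow> nat"
  assumes q: "0 \<le> q" "q \<le> 1"
  shows "measure_pmf.expectation (noise q B m)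
      (\<lambda>G. of_bool (f (lead (\<lambda>j. c j + of_bool (f j) + G j) m))) \<le>
    measure_pmf.expectation (noise q B m) (\<lambda>G. of_bool (f (lead (\<lambda>j. c j + G j) m))) +
      (1 - q) + real (Suc m) * q ^ B"
proof -
  let ?E = "measure_pmf.expectation (noise q B m)"
  let ?J = "\<lambda>G. lead (\<lambda>j. c j + of_bool (f j) + G j) m"
  let ?I = "\<lambda>G. lead (\<lambda>j. c j + G j) m"
  have split: "?E (\<lambda>G. g (l G)) = (\<Sum>i\<le>m. g i * ?E (\<lambda>G. of_bool (l G = i)))"
    if "\<And>G. l G \<le> m" for l :: "(nat \<Rightarrow> nat) \<Rightarrow> nat" and g :: "nat \<Rightarrow> real"
  proof -
    have "g (l G) = (\<Sum>i\<le>m. g i * of_bool (l G = i))" for G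
      using that [of G] by (simp add: of_bool_def if_distrib sum.delta cong: if_cong)
    then have "?E (\<lambda>G. g (l G)) = ?E (\<lambda>G. \<Sum>i\<le>m. g i * of_bool (l G = i))"
      by (intro Bochner_Integration.integral_cong refl)
    also have "\<dots> = (\<Sum>i\<le>m. g i * ?E (\<lambda>G. of_bool (l G = i)))"
      by (subst Bochner_Integration.integral_sum) auto
    finally show ?thesis .
  qed
  have one: "(\<Sum>i\<le>m. ?E (\<lambda>G. of_bool (?J G = i))) = (1 :: real)"
    using split [of ?J "\<lambda>_. 1"] by (simp add: lead_le)
  have "?E (\<lambda>G. of_bool (f (?J G))) =
      (\<Sum>i\<le>m. of_bool (f i) * ?E (\<lambda>G. of_bool (?J G = i)) :: real)"
    by (rule split [of ?J "\<lambda>i. of_bool (f i)"]) (rule lead_le)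
  also have "\<dots> \<le> (\<Sum>i\<le>m. of_bool (f i) * ?E (\<lambda>G. of_bool (?I G = i)) +
      ((1 - q) * ?E (\<lambda>G. of_bool (?J G = i)) + q ^ B))"
  proof (rule sum_mono)
    fix i assume "i \<in> {..m}"
    then have "q * ?E (\<lambda>G. of_bool (?J G = i)) \<le> ?E (\<lambda>G. of_bool (?I G = i)) + q ^ B"
      by (intro lead_stability q) auto
    moreover have "0 \<le> (1 - q) * ?E (\<lambda>G. of_bool (?J G = i))" "0 \<le> q ^ B"
      using q by (auto intro!: mult_nonneg_nonneg)
    ultimately show "of_bool (f i) * ?E (\<lambda>G. of_bool (?J G = i)) \<le>
        of_bool (f i) * ?E (\<lambda>G. of_bool (?I G = i)) +
        ((1 - q) * ?E (\<lambda>G. of_bool (?J G = i)) + q ^ B)"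
      by (cases "f i") (auto simp: algebra_simps)
  qed
  also have "\<dots> = ?E (\<lambda>G. of_bool (f (?I G))) + (1 - q) + real (Suc m) * q ^ B"
    using split [of ?I "\<lambda>i. of_bool (f i)"] one
    by (simp add: sum.distrib lead_le flip: sum_distrib_left)
  finally show ?thesis .
qed

text \<open>The largest noise is at most \<open>M\<close> plus the sum of all excesses over
  \<open>M\<close>, which avoids handling the distribution of a maximum.\<close>

lemma expectation_lead_noise:
  assumes q: "0 \<le> q" "q < 1"
  shows "measure_pmf.expectation (noise q B m) (\<lambda>G. real (G (lead G m))) \<le>
    real M + real (Suc m) * (q ^ M / (1 - q))"
proof -
  let ?E = "measure_pmf.expectation (noise q B m)"
  have comp: "?E (\<lambda>G. real (G i - M)) \<le> q ^ M / (1 - q)" if "i \<le> m" for i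
  proof -
    have "map_pmf (\<lambda>G. G i) (noise q B m) = trunc_geom q B"
      using that by (subst Pi_pmf_component) auto
    then have "?E (\<lambda>G. real (G i - M)) =
        measure_pmf.expectation (trunc_geom q B) (\<lambda>g. real (g - M))"
      using integral_map_pmf [of "\<lambda>G. G i" "noise q B m" "\<lambda>g. real (g - M)"] by simp
    with expectation_trunc_geom_excess [OF q] show ?thesis by simp
  qed
  have "?E (\<lambda>G. real (G (lead G m))) \<le> ?E (\<lambda>G. real M + (\<Sum>i\<le>m. real (G i - M)))"
  proof (rule expectation_mono_finite)
    fix G :: "nat \<Rightarrow> nat"
    have "real (G (lead G m) - M) \<le> (\<Sum>i\<le>m. real (G i - M))"
      by (rule member_le_sum) (auto simp: lead_le)
    then show "real (G (lead G m)) \<le> real M + (\<Sum>i\<le>m. real (G i - M))" by linarith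
  qed simp
  also have "\<dots> = real M + (\<Sum>i\<le>m. ?E (\<lambda>G. real (G i - M)))"
    by (simp add: Bochner_Integration.integral_add Bochner_Integration.integral_sum)
  also have "\<dots> \<le> real M + (\<Sum>i\<le>m. q ^ M / (1 - q))"
    using comp by (intro add_left_mono sum_mono) auto
  finally show ?thesis by simp
qed

section \<open>Regret bound\<close>

text \<open>In the experts setting, \<open>f t i\<close> says that candidate \<open>i\<close> gains
  in round \<open>t\<close>.\<close>

definition cnt :: "(nat \<Rightarrow> nat \<Rightarrow> bool) \<Rightarrow> nat \<Rightarrow> nat \<Rightarrow> nat" where
  "cnt f t i = (\<Sum>\<tau><t. of_bool (f \<tau> i))"

lemma cnt_Suc: "cnt f (Suc t) i = cnt f t i + of_bool (f t i)"
  by (simp add: cnt_def)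

text \<open>A player who follows the leader with the current round already counted loses to no fixed
  candidate, except for the noise, which acts as gains made before the first round.\<close>

lemma be_the_leader:
  assumes "i \<le> m"
  shows "cnt f T i \<le>
    (\<Sum>t<T. of_bool (f t (lead (\<lambda>j. cnt f (Suc t) j + G j) m))) + G (lead G m)"
proof -
  let ?L = "\<lambda>t. lead (\<lambda>j. cnt f t j + G j) m"
  \<comment> \<open>The induction compares with the final leader, noise included; for
    \<open>T = 0\<close> this leader is \<open>lead G m\<close>.\<close>
  have "cnt f T (?L T) + G (?L T) \<le> (\<Sum>t<T. of_bool (f t (?L (Suc t)))) + G (lead G m)"
  proof (induction T)
    case (Suc T)
    have "cnt f T (?L (Suc T)) + G (?L (Suc T)) \<le> cnt f T (?L T) + G (?L T)"
      using lead_max [of "?L (Suc T)" m "\<lambda>j. cnt f T j + G j"] by (simp add: lead_le)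
    with Suc show ?case by (simp add: cnt_Suc)
  qed (simp add: cnt_def)
  moreover have "cnt f T i + G i \<le> cnt f T (?L T) + G (?L T)"
    using lead_max [of i m "\<lambda>j. cnt f T j + G j"] assms by simp
  ultimately show ?thesis by linarith
qed

text \<open>\<open>be_the_leader\<close> is averaged over the noise. Each round then pays the
  stability error for replacing the leader that knows the round by the one that does not, and the
  initial noise is paid once. \<open>M\<close> is a free parameter of the noise estimate.\<close>

theorem perturbed_leader_regret:
  assumes q: "0 \<le> q" "q < 1" and i: "i \<le> m"
  shows "real (cnt f T i) \<le>
    (\<Sum>t<T. measure_pmf.expectation (noise q B m)
        (\<lambda>G. of_bool (f t (lead (\<lambda>j. cnt f t j + G j) m)))) +
    (real M + real (Suc m) * (q ^ M / (1 - q))) +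
    real T * ((1 - q) + real (Suc m) * q ^ B)"
proof -
  let ?E = "measure_pmf.expectation (noise q B m)"
  have "real (cnt f T i) = ?E (\<lambda>_. real (cnt f T i))" by simp
  also have "\<dots> \<le> ?E (\<lambda>G. (\<Sum>t<T. of_bool (f t (lead (\<lambda>j. cnt f (Suc t) j + G j) m))) +
      real (G (lead G m)))"
  proof (rule expectation_mono_finite)
    fix G
    show "real (cnt f T i) \<le> (\<Sum>t<T. of_bool (f t (lead (\<lambda>j. cnt f (Suc t) j + G j) m))) +
        real (G (lead G m))"
      using of_nat_mono [OF be_the_leader [OF i, of f T G], where 'a = real] by simp
  qed simp
  also have "\<dots> = (\<Sum>t<T. ?E (\<lambda>G. of_bool (f t (lead (\<lambda>j. cnt f (Suc t) j + G j) m)))) +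
      ?E (\<lambda>G. real (G (lead G m)))"
    by (simp add: Bochner_Integration.integral_add Bochner_Integration.integral_sum
        del: sum_of_bool_eq)
  also have "\<dots> \<le> (\<Sum>t<T. ?E (\<lambda>G. of_bool (f t (lead (\<lambda>j. cnt f t j + G j) m))) +
      ((1 - q) + real (Suc m) * q ^ B)) + (real M + real (Suc m) * (q ^ M / (1 - q)))"
    using lead_gain_stability [where c = "cnt f _" and f = "f _"] q expectation_lead_noise [OF q]
    by (intro add_mono sum_mono) (simp_all add: cnt_Suc add.assoc)
  also have "\<dots> = (\<Sum>t<T. ?E (\<lambda>G. of_bool (f t (lead (\<lambda>j. cnt f t j + G j) m)))) +
    (real M + real (Suc m) * (q ^ M / (1 - q))) +
    real T * ((1 - q) + real (Suc m) * q ^ B)"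
    by (simp add: sum.distrib)
  finally show ?thesis .
qed

section \<open>Geometric noise from uniform bits\<close>

text \<open>A nonzero block of \<open>k\<close> uniform bits is a success of probability \<open>1 - 2\<^bsup>-k\<^esup>\<close>.\<close>

fun runs :: "nat \<Rightarrow> nat \<Rightarrow> bool list \<Rightarrow> nat" where
  "runs k 0 \<beta> = 0"
| "runs k (Suc B) \<beta> = (if \<exists>b<k. \<beta> ! b then Suc (runs k B (drop k \<beta>)) else 0)"

text \<open>The form that a circuit can compute: the unary wire \<open>j\<close> is the conjunction
  of the first \<open>j\<close> coins.\<close>

lemma runs_ge_iff:
  "j \<le> runs k B \<beta> \<longleftrightarrow> j \<le> B \<and> (\<forall>t<j. \<exists>b<k. \<beta> ! (t * k + b))"
  if "length \<beta> = B * k"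
  using that
proof (induction B arbitrary: j \<beta>)
  case (Suc B)
  show ?case
  proof (cases j)
    case (Suc j')
    have "(\<forall>t<j'. \<exists>b<k. drop k \<beta> ! (t * k + b)) \<longleftrightarrow> (\<forall>t<j'. \<exists>b<k. \<beta> ! (Suc t * k + b))"
      using Suc.prems by (simp add: add.assoc)
    with Suc Suc.IH [of "drop k \<beta>" j'] Suc.prems show ?thesis
      by (auto simp: All_less_Suc2)
  qed simp
qed auto

lemma finite_length_eq [simp]: "finite {\<rho> :: bool list. length \<rho> = r}"
  using finite_lists_length_eq [of "UNIV :: bool set" r] by simp

lemma length_eq_nonempty: "{\<rho> :: bool list. length \<rho> = r} \<noteq> {}"
  by (auto intro: exI [of _ "replicate r True"])

lemma card_length_eq: "card {\<rho> :: bool list. length \<rho> = r} = 2 ^ r"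
  using card_lists_length_eq [of "UNIV :: bool set" r] by simp

lemma set_uniform_bits [simp]: "set_pmf (uniform_bits r) = {\<rho>. length \<rho> = r}"
  unfolding uniform_bits_def by (rule set_pmf_of_set) (simp_all add: length_eq_nonempty del: Collect_empty_eq)

lemma uniform_bits_add:
  "uniform_bits (a + b) = map_pmf (\<lambda>(u, v). u @ v) (pair_pmf (uniform_bits a) (uniform_bits b))"
proof -
  let ?A = "{\<rho> :: bool list. length \<rho> = a}" and ?B = "{\<rho> :: bool list. length \<rho> = b}"
  have "pair_pmf (uniform_bits a) (uniform_bits b) = pmf_of_set (?A \<times> ?B)"
    unfolding uniform_bits_def
    using length_eq_nonempty
    by (intro pmf_eqI)
      (auto simp: pmf_pair card_cartesian_product indicator_def simp del: Collect_empty_eq)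
  moreover have "bij_betw (\<lambda>(u, v). u @ v) (?A \<times> ?B) {\<rho>. length \<rho> = a + b}"
    by (rule bij_betw_byWitness [where f' = "\<lambda>\<rho>. (take a \<rho>, drop a \<rho>)"]) auto
  ultimately show ?thesis
    unfolding uniform_bits_def using length_eq_nonempty
    by (simp add: map_pmf_of_set_bij_betw del: Collect_empty_eq)
qed

text \<open>Among the \<open>2 ^ k\<close> equally likely lists only the all-\<open>False\<close>
  one is a failure.\<close>

lemma map_uniform_bits_ex:
  "map_pmf (\<lambda>\<beta>. \<exists>b<k. \<beta> ! b) (uniform_bits k) = bernoulli_pmf (1 - 1 / 2 ^ k)"
proof (rule pmf_eqI)
  let ?C = "map_pmf (\<lambda>\<beta>. \<exists>b<k. \<beta> ! b) (uniform_bits k)"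
  have "length \<rho> = k \<and> \<not> (\<exists>b<k. \<rho> ! b) \<longleftrightarrow> \<rho> = replicate k False" for \<rho>
    unfolding list_eq_iff_nth_eq by (metis length_replicate nth_replicate)
  then have "{\<rho>. length \<rho> = k} \<inter> (\<lambda>\<beta>. \<exists>b<k. \<beta> ! b) -` {False} = {replicate k False}"
    by blast
  then have F: "pmf ?C False = 1 / 2 ^ k"
    using length_eq_nonempty [of k]
    by (simp add: pmf_map uniform_bits_def measure_pmf_of_set card_length_eq
        del: Collect_empty_eq)
  have T: "pmf ?C True = 1 - pmf ?C False"
    using pmf_False_conv_True [of ?C] by simp
  show "pmf ?C b = pmf (bernoulli_pmf (1 - 1 / 2 ^ k)) b" for b
    by (cases b) (simp_all add: F T)
qed

lemma map_runs_uniform_bits: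
  "map_pmf (runs k B) (uniform_bits (B * k)) = trunc_geom (1 - 1 / 2 ^ k) B"
proof (induction B)
  case 0
  then show ?case by (simp add: uniform_bits_def map_pmf_const)
next
  case (Suc B)
  have "map_pmf (runs k (Suc B)) (uniform_bits (Suc B * k)) =
      uniform_bits k \<bind> (\<lambda>u. map_pmf (\<lambda>v. runs k (Suc B) (u @ v)) (uniform_bits (B * k)))"
    by (simp add: uniform_bits_add pair_pmf_def map_pmf_def bind_assoc_pmf bind_return_pmf
        del: runs.simps)
  also have "\<dots> = uniform_bits k \<bind> (\<lambda>u. if \<exists>b<k. u ! b
      then map_pmf Suc (map_pmf (runs k B) (uniform_bits (B * k))) else return_pmf 0)"
  proof (rule bind_pmf_cong [OF refl])
    fix u assume "u \<in> set_pmf (uniform_bits k)"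
    then have "runs k (Suc B) (u @ v) = (if \<exists>b<k. u ! b then Suc (runs k B v) else 0)" for v
      by (auto simp: nth_append)
    then show "map_pmf (\<lambda>v. runs k (Suc B) (u @ v)) (uniform_bits (B * k)) =
        (if \<exists>b<k. u ! b
         then map_pmf Suc (map_pmf (runs k B) (uniform_bits (B * k))) else return_pmf 0)"
      by (cases "\<exists>b<k. u ! b") (simp_all only: map_pmf_comp map_pmf_const if_True if_False)
  qed
  also have "\<dots> = map_pmf (\<lambda>\<beta>. \<exists>b<k. \<beta> ! b) (uniform_bits k) \<bind> (\<lambda>b. if b
      then map_pmf Suc (trunc_geom (1 - 1 / 2 ^ k) B) else return_pmf 0)"
    by (simp only: Suc bind_map_pmf)
  also have "\<dots> = trunc_geom (1 - 1 / 2 ^ k) (Suc B)"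
    by (simp only: map_uniform_bits_ex trunc_geom.simps)
  finally show ?case .
qed

text \<open>Disjoint blocks of uniform bits are independent; the induction splits off the last block
  as coordinate \<open>N\<close>. The value \<open>d\<close> beyond the blocks matches the default
  of \<open>Pi_pmf\<close>.\<close>

lemma map_blocks_uniform_bits:
  "map_pmf (\<lambda>\<rho> i. if i < N then g (take M (drop (i * M) \<rho>)) else d) (uniform_bits (N * M)) =
    Pi_pmf {..<N} d (\<lambda>_. map_pmf g (uniform_bits M))"
proof (induction N)
  case 0
  then show ?case by (simp add: map_pmf_const)
next
  case (Suc N)
  let ?F = "\<lambda>N \<rho> i. if i < N then g (take M (drop (i * M) \<rho>)) else d"
  have split: "?F (Suc N) (u @ v) = (?F N u)(N := g v)" if "length u = N * M" "length v = M" for u v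
  proof
    fix i
    show "?F (Suc N) (u @ v) i = ((?F N u)(N := g v)) i"
    proof (cases "i < N")
      case True
      then have "i * M + M \<le> N * M"
        by (metis Suc_leI mult_Suc mult_le_mono1 add.commute)
      with True that show ?thesis by simp
    qed (use that in auto)
  qed
  have "map_pmf (?F (Suc N)) (uniform_bits (Suc N * M)) =
      map_pmf (?F (Suc N) \<circ> (\<lambda>(u, v). u @ v)) (pair_pmf (uniform_bits (N * M)) (uniform_bits M))"
    by (simp only: mult_Suc add.commute [of M] uniform_bits_add map_pmf_compose o_apply)
  also have "\<dots> = map_pmf (\<lambda>(u, v). (?F N u)(N := g v))
      (pair_pmf (uniform_bits (N * M)) (uniform_bits M))"
    by (rule map_pmf_cong [OF refl]) (use split in \<open>auto simp only: o_apply set_pair_pmf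
        set_uniform_bits mem_Collect_eq mem_Sigma_iff prod.case\<close>)
  also have "\<dots> = map_pmf (\<lambda>(y, f). f(N := y))
      (pair_pmf (map_pmf g (uniform_bits M)) (map_pmf (?F N) (uniform_bits (N * M))))"
    by (subst pair_commute_pmf)
      (simp only: map_pair [symmetric] map_pmf_comp case_prod_unfold fst_conv snd_conv)
  also have "\<dots> = Pi_pmf {..<Suc N} d (\<lambda>_. map_pmf g (uniform_bits M))"
    by (simp add: Suc Pi_pmf_insert lessThan_Suc)
  finally show ?case .
qed

section \<open>The perturbed leader as a circuit\<close>

text \<open>The wires of a unary counter with value \<open>S\<close>.\<close>

definition thr :: "nat \<Rightarrow> (bool list \<Rightarrow> nat) \<Rightarrow> (bool list \<Rightarrow> bool) set" where
  "thr L S = (\<lambda>j inp. j \<le> S inp) ` {..L}"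

lemma thrI: "j \<le> L \<Longrightarrow> (\<lambda>inp. j \<le> S inp) \<in> thr L S"
  by (auto simp: thr_def)

text \<open>New wire \<open>j\<close> is old wire \<open>j\<close>, or old wire \<open>j - 1\<close>
  together with \<open>b\<close>: two gates. At \<open>j = 0\<close> the truncated subtraction is
  harmless, since wire 0 is always true.\<close>

lemma synth_thr_incr:
  assumes "thr L S \<subseteq> A" "b \<in> A"
  shows "synth k A (Suc L * 2) (thr L (\<lambda>inp. of_bool (b inp) + S inp))"
proof -
  have "synth k A 2 {\<lambda>inp. j \<le> of_bool (b inp) + S inp}" if "j \<in> {..L}" for j
  proof -
    let ?carry = "\<lambda>inp. j - 1 \<le> S inp \<and> b inp" and ?\<phi> = "\<lambda>inp. j \<le> S inp"
    have mem: "?\<phi> \<in> A" "(\<lambda>inp. j - 1 \<le> S inp) \<in> A"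
      using that assms(1) thrI [of j L S] thrI [of "j - 1" L S] by auto
    have "synth k A (1 + 1) ({?carry} \<union> {\<lambda>inp. ?\<phi> inp \<or> ?carry inp})"
      by (rule synth_trans; rule synth_gate) (use mem assms(2) in auto)
    then have "synth k A 2 {\<lambda>inp. ?\<phi> inp \<or> ?carry inp}"
      by (rule synth_mono) auto
    then show ?thesis by (rule synth_cong) auto
  qed
  then show ?thesis
    unfolding thr_def using synth_image [of "{..L}" k A 2] by simp
qed

text \<open>The counters start at the values \<open>S i\<close>, so noise is added without any
  gates. Each round pays, per candidate, \<open>c\<close> gates for the gain and
  \<open>Suc L * 2\<close> for the increment.\<close>

lemma synth_counters:
  assumes "\<And>i. i < N \<Longrightarrow> thr L (S i) \<subseteq> A"
    and "\<And>t i. t < T \<Longrightarrow> i < N \<Longrightarrow> synth k A c {f t i}"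
  shows "synth k A (T * (N * (c + Suc L * 2)))
    (\<Union>i<N. thr L (\<lambda>inp. cnt (\<lambda>t i. f t i inp) T i + S i inp))"
  using assms(2)
proof (induction T)
  case 0
  have "(\<Union>i<N. thr L (\<lambda>inp. cnt (\<lambda>t i. f t i inp) 0 i + S i inp)) \<subseteq> A"
    using assms(1) by (auto simp: cnt_def)
  then show ?case by (rule synth_subset)
next
  case (Suc T)
  let ?C = "\<lambda>T i inp. cnt (\<lambda>t i. f t i inp) T i + S i inp"
  let ?B = "\<Union>i<N. thr L (?C T i)"
  have "synth k (A \<union> ?B) (c + Suc L * 2) (thr L (?C (Suc T) i))" if "i \<in> {..<N}" for i
  proof -
    have "synth k (A \<union> ?B) (c + Suc L * 2)
        ({f T i} \<union> thr L (\<lambda>inp. of_bool (f T i inp) + ?C T i inp))"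
    proof (rule synth_trans)
      show "synth k (A \<union> ?B) c {f T i}"
        by (rule synth_mono [OF Suc.prems]) (use that in auto)
    qed (rule synth_thr_incr; use that in auto)
    then show ?thesis
      by (rule synth_mono) (auto simp: cnt_Suc ac_simps)
  qed
  from synth_UN [of "{..<N}" k "A \<union> ?B" "c + Suc L * 2" "\<lambda>i. thr L (?C (Suc T) i)", OF _ this]
  have "synth k (A \<union> ?B) (N * (c + Suc L * 2)) (\<Union>i<N. thr L (?C (Suc T) i))" by simp
  from synth_trans [OF Suc.IH this] Suc.prems show ?case
    by (auto elim!: synth_mono)
qed

text \<open>A scan that carries the thresholds of the best total so far and the string of its
  candidate. Each further candidate costs \<open>2 * L + 3\<close> gates for the comparison,
  \<open>Suc L\<close> for the new thresholds and \<open>l\<close> for the choice of string.\<close>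

lemma synth_lead:
  assumes "\<And>i. i \<le> m \<Longrightarrow> thr L (S i) \<subseteq> A" "\<And>i inp. S i inp \<le> L"
  shows "synth k A (l + m * (3 * L + 4 + l))
    (thr L (\<lambda>inp. S (lead (\<lambda>i. S i inp) m) inp) \<union>
      (\<lambda>b inp. zl (lead (\<lambda>i. S i inp) m) ! b) ` {..<l})"
  using assms(1)
proof (induction m)
  case 0
  have "synth k A (card {..<l} * 1) ((\<lambda>b inp. zl 0 ! b) ` {..<l})"
    by (rule synth_image) (simp_all only: synth_const finite_lessThan)
  from synth_trans [OF synth_subset [of "thr L (S 0)" A k 0] synth_mono [OF this]] 0
  show ?case by simp
next
  case (Suc m)
  let ?lead = "\<lambda>m inp. lead (\<lambda>i. S i inp) m"
  let ?best = "\<lambda>m inp. S (?lead m inp) inp"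
  let ?out = "\<lambda>m b inp. zl (?lead m inp) ! b"
  let ?B = "thr L (?best m) \<union> ?out m ` {..<l}"
  let ?\<gamma> = "\<lambda>j inp. \<not> j \<le> ?best m inp \<and> j \<le> S (Suc m) inp"
  let ?gt = "\<lambda>inp. ?best m inp < S (Suc m) inp"
  define A' where "A' = A \<union> ?B"
  have mem: "(\<lambda>inp. j \<le> ?best m inp) \<in> A'" "(\<lambda>inp. j \<le> S (Suc m) inp) \<in> A'" if "j \<le> L" for j
    using that Suc.prems [of "Suc m"] thrI [of j L "S (Suc m)"] thrI [of j L "?best m"]
    by (auto simp: A'_def)
  have "synth k A' (card {..L} * 1) (?\<gamma> ` {..L})"
    by (rule synth_image) (auto intro!: synth_gate [where f = "\<lambda>a b. \<not> a \<and> b", simplified] mem)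
  moreover have "synth k (A' \<union> ?\<gamma> ` {..L}) (Suc L + 1) {?gt}"
  proof (rule synth_cong)
    show "synth k (A' \<union> ?\<gamma> ` {..L}) (Suc L + 1) {\<lambda>inp. \<exists>j<Suc L. ?\<gamma> j inp}"
      by (rule synth_Ex_less) auto
    \<comment> \<open>A strictly larger total is witnessed by a threshold that it reaches and the
      old best misses; the bound \<open>L\<close> on the totals puts that threshold in
      range.\<close>
    show "(\<exists>j<Suc L. ?\<gamma> j inp) = ?gt inp" for inp
      using assms(2) [of "Suc m" inp] by (auto simp: less_Suc_eq_le not_le)
  qed
  ultimately have "synth k A' (Suc L + (Suc L + 1)) (?\<gamma> ` {..L} \<union> {?gt})"
    using synth_trans by force
  then have gt: "synth k A' (2 * L + 3) {?gt}"
    by (rule synth_mono) auto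
  have best: "synth k (A' \<union> {?gt}) (card {..L} * 1) (thr L (?best (Suc m)))"
    unfolding thr_def
  proof (rule synth_image)
    fix j assume "j \<in> {..L}"
    \<comment> \<open>The thresholds of a maximum are the disjunctions of the thresholds.\<close>
    then have "synth k (A' \<union> {?gt}) 1 {\<lambda>inp. j \<le> ?best m inp \<or> j \<le> S (Suc m) inp}"
      using mem [of j] by (intro synth_gate) auto
    then show "synth k (A' \<union> {?gt}) 1 {\<lambda>inp. j \<le> ?best (Suc m) inp}"
      by (rule synth_cong) auto
  qed simp
  have "synth k (A' \<union> {?gt}) (card {..<l} * 1) (?out (Suc m) ` {..<l})"
  proof (rule synth_image)
    fix b assume "b \<in> {..<l}"
    \<comment> \<open>The bit \<open>zl (Suc m) ! b\<close> is a constant and is built into the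
      gate, so that a two-input gate can choose.\<close>
    then have "synth k (A' \<union> {?gt}) 1
        {\<lambda>inp. (\<lambda>u v. if u then zl (Suc m) ! b else v) (?gt inp) (?out m b inp)}"
      by (intro synth_gate) (auto simp: A'_def)
    then show "synth k (A' \<union> {?gt}) 1 {?out (Suc m) b}"
      by (rule synth_cong) auto
  qed simp
  from synth_trans [OF best synth_mono [OF this Un_upper1 order_refl order_refl]]
  have "synth k (A' \<union> {?gt}) (Suc L + l) (thr L (?best (Suc m)) \<union> ?out (Suc m) ` {..<l})"
    by simp
  from synth_trans [OF gt this]
  have "synth k (A \<union> ?B) (2 * L + 3 + (Suc L + l))
      ({?gt} \<union> (thr L (?best (Suc m)) \<union> ?out (Suc m) ` {..<l}))"
    by (simp add: A'_def)
  from synth_trans [OF Suc.IH this] Suc.prems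
  have "synth k A (l + m * (3 * L + 4 + l) + (2 * L + 3 + (Suc L + l)))
      (?B \<union> ({?gt} \<union> (thr L (?best (Suc m)) \<union> ?out (Suc m) ` {..<l})))"
    by simp
  then show ?case
    by (rule synth_mono) auto
qed

text \<open>Each prefix conjunction extends the previous one by a single gate; the initial 1 pays
  for the empty conjunction.\<close>

lemma synth_prefix_all:
  assumes "\<And>t. t < B \<Longrightarrow> synth K A c {\<phi> t}"
  shows "synth K A (1 + B * (c + 1)) ((\<lambda>j inp. \<forall>t<j. \<phi> t inp) ` {..B})"
  using assms
proof (induction B)
  case 0
  show ?case using synth_const [of K A True] by simp
next
  case (Suc B)
  let ?P = "\<lambda>j inp. \<forall>t<j. \<phi> t inp"
  let ?A = "A \<union> ?P ` {..B}"
  have "synth K ?A (c + 1) ({\<phi> B} \<union> {\<lambda>inp. ?P B inp \<and> \<phi> B inp})"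
  proof (rule synth_trans)
    show "synth K ?A c {\<phi> B}" by (rule synth_mono [OF Suc.prems]) auto
    show "synth K (?A \<union> {\<phi> B}) 1 {\<lambda>inp. ?P B inp \<and> \<phi> B inp}"
      by (rule synth_gate) auto
  qed
  then have "synth K ?A (c + 1) {\<lambda>inp. ?P B inp \<and> \<phi> B inp}"
    by (rule synth_mono) auto
  then have "synth K ?A (c + 1) {?P (Suc B)}"
    by (rule synth_cong) (auto simp: less_Suc_eq)
  from synth_trans [OF Suc.IH this] Suc.prems
  have "synth K A (1 + B * (c + 1) + (c + 1)) (?P ` {..B} \<union> {?P (Suc B)})" by simp
  then show ?case
    by (rule synth_mono) (auto simp: atMost_Suc)
qed

lemma synth_noise:
  fixes n N B k :: nat
  defines "K \<equiv> n + N * (B * k)"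
  assumes i: "i < N" and A: "(\<lambda>j inp. inp ! j) ` {..<K} \<subseteq> A"
  shows "synth K A (2 + B * (k + 2))
    (thr L (\<lambda>inp. runs k B (take (B * k) (drop (i * (B * k)) (drop n inp)))))"
proof -
  let ?coin = "\<lambda>t inp. \<exists>b<k. inp ! (n + i * (B * k) + (t * k + b))"
  let ?P = "\<lambda>j inp. \<forall>t<j. ?coin t inp"
  let ?r = "\<lambda>inp. runs k B (take (B * k) (drop (i * (B * k)) (drop n inp)))"
  have inner: "t * k + b < B * k" if "t < B" "b < k" for t b
  proof -
    have "t * k + b < Suc t * k" using that by simp
    also have "\<dots> \<le> B * k" using that by (intro mult_le_mono1) auto
    finally show ?thesis .
  qed
  have outer: "i * (B * k) + B * k \<le> N * (B * k)"
    using mult_le_mono1 [of "Suc i" N "B * k"] i by (simp add: add.commute)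
  have coin: "synth K A (k + 1) {?coin t}" if "t < B" for t
  proof (rule synth_Ex_less)
    fix b assume "b < k"
    with inner [OF that] outer have "n + i * (B * k) + (t * k + b) < K"
      unfolding K_def by fastforce
    with A show "(\<lambda>inp. inp ! (n + i * (B * k) + (t * k + b))) \<in> A" by auto
  qed
  \<comment> \<open>The constant \<open>False\<close> serves all thresholds above \<open>B\<close>,
    so the cost does not depend on \<open>L\<close>.\<close>
  have "synth K A (1 + (1 + B * (k + 1 + 1))) ({\<lambda>_. False} \<union> ?P ` {..B})"
    by (rule synth_trans [OF synth_const synth_mono [OF synth_prefix_all [OF coin]]]) auto
  then have "synth K A (1 + (1 + B * (k + 1 + 1))) (thr L ?r)"
  proof (rule synth_cong_set)
    fix \<psi> assume "\<psi> \<in> thr L ?r"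
    then obtain j where \<psi>: "\<psi> = (\<lambda>inp. j \<le> ?r inp)" by (auto simp: thr_def)
    have *: "j \<le> ?r inp \<longleftrightarrow> j \<le> B \<and> ?P j inp" if "length inp = K" for inp
    proof -
      let ?\<beta> = "take (B * k) (drop (i * (B * k)) (drop n inp))"
      have bit: "?\<beta> ! (t * k + b) = inp ! (n + i * (B * k) + (t * k + b))" if "t < B" "b < k" for t b
      proof -
        have "n + i * (B * k) \<le> length inp" using \<open>length inp = K\<close> i by (simp add: K_def)
        with inner [OF that] show ?thesis by (simp add: add.commute [of n] add.assoc)
      qed
      have "length ?\<beta> = B * k"
        using outer that by (simp add: K_def)
      then have "j \<le> ?r inp \<longleftrightarrow> j \<le> B \<and> (\<forall>t<j. \<exists>b<k. ?\<beta> ! (t * k + b))"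
        by (rule runs_ge_iff)
      also have "\<dots> \<longleftrightarrow> j \<le> B \<and> ?P j inp"
        using bit by (meson order.strict_trans2)
      finally show ?thesis .
    qed
    show "\<exists>\<phi>\<in>{\<lambda>_. False} \<union> ?P ` {..B}. \<forall>inp. length inp = K \<longrightarrow> \<phi> inp = \<psi> inp"
    proof (cases "j \<le> B")
      case True
      then show ?thesis using * unfolding \<psi> by (intro bexI [of _ "?P j"]) auto
    next
      case False
      then show ?thesis using * unfolding \<psi> by (intro bexI [of _ "\<lambda>_. False"]) auto
    qed
  qed
  then show ?thesis by (simp add: add.assoc)
qed

lemma lead_cong: "(\<And>j. j \<le> m \<Longrightarrow> S j = S' j) \<Longrightarrow> lead S m = lead S' m"
  by (induction m) (auto simp: lead_le le_SucI)

lemma runs_le: "runs k B \<beta> \<le> B"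
  by (induction B arbitrary: \<beta>) auto

lemma cnt_le: "cnt f T i \<le> T"
  using sum_bounded_above [of "{..<T}" "\<lambda>t. of_bool (f t i) :: nat" 1] by (simp add: cnt_def)

text \<open>The flag \<open>False\<close> stands for the negated distinguisher, so a candidate gains
  when the possibly negated distinguisher accepts it.\<close>

definition gain ::
  "(circuit \<times> bool) list \<Rightarrow> (nat \<Rightarrow> bool list) \<Rightarrow> bool list \<Rightarrow> nat \<Rightarrow> nat \<Rightarrow> bool" where
  "gain Ds zl x t i \<longleftrightarrow> (eval_circuit (fst (Ds ! t)) (x @ zl i) = [True]) = snd (Ds ! t)"

definition distinguisher :: "nat \<Rightarrow> nat \<Rightarrow> circuit \<Rightarrow> bool" where
  "distinguisher k s D \<longleftrightarrow> wf_circuit D k 1 \<and> circuit_size D \<le> s"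

lemma synth_gain:
  assumes D: "distinguisher (n + l) s (fst (Ds ! t))" and zl: "length (zl i) = l"
    and A: "(\<lambda>j inp. inp ! j) ` {..<K} \<subseteq> A" "range (\<lambda>b _. b) \<subseteq> A" and "n \<le> K"
  shows "synth K A (s + 1) {\<lambda>inp. gain Ds zl (take n inp) t i}"
proof -
  let ?D = "fst (Ds ! t)"
  \<comment> \<open>The distinguisher reads \<open>x\<close> from the input wires, whereas the
    candidate string is hard-wired by constants.\<close>
  let ?\<phi>s = "map (\<lambda>j inp. inp ! j) [0..<n] @ map (\<lambda>b _. b) (zl i)"
  have eq: "map (\<lambda>\<phi>. \<phi> inp) ?\<phi>s = take n inp @ zl i" if "length inp = K" for inp
    using that \<open>n \<le> K\<close> by (auto simp: list_eq_iff_nth_eq nth_append)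
  have len: "length ?\<phi>s = n + l" using zl by simp
  have "synth K A (circuit_size ?D) {\<lambda>inp. eval_circuit ?D (map (\<lambda>\<phi>. \<phi> inp) ?\<phi>s) = [True]}"
  proof (rule synth_circuit)
    show "wf_circuit ?D (length ?\<phi>s) 1" using D len by (simp add: distinguisher_def)
    show "set ?\<phi>s \<subseteq> A" using A \<open>n \<le> K\<close> by auto
  qed
  then have "synth K A s {\<lambda>inp. eval_circuit ?D (take n inp @ zl i) = [True]}"
    using D by (intro synth_cong [OF synth_mono])
      (auto simp: distinguisher_def simp del: map_append simp flip: eq)
  moreover have "synth K (A \<union> {\<lambda>inp. eval_circuit ?D (take n inp @ zl i) = [True]}) 1
      {\<lambda>inp. (\<lambda>a b. a = snd (Ds ! t)) (eval_circuit ?D (take n inp @ zl i) = [True])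
        (eval_circuit ?D (take n inp @ zl i) = [True])}"
    by (rule synth_gate) auto
  ultimately show ?thesis
    unfolding gain_def by (blast intro: synth_mono [OF synth_trans])
qed

text \<open>The summands of the size pay in turn for the two constants, the noise, the rounds of
  counting and the selection of the leader. Totals stay within \<open>L\<close>, as the noise is at
  most \<open>B\<close> and the count at most \<open>length Ds\<close>.\<close>

lemma perturbed_leader_circuit:
  fixes B :: nat and Ds :: "(circuit \<times> bool) list"
  assumes Ds: "\<And>D \<sigma>. (D, \<sigma>) \<in> set Ds \<Longrightarrow> distinguisher (n + l) s D"
    and zl: "\<And>i. i \<le> m \<Longrightarrow> length (zl i) = l"
  defines "L \<equiv> B + length Ds"
  obtains h where "wf_circuit h (n + Suc m * (B * k)) l"
    "circuit_size h \<le> 2 + Suc m * (2 + B * (k + 2)) +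
      length Ds * (Suc m * (s + 1 + Suc L * 2)) + (l + m * (3 * L + 4 + l))"
    "\<And>x \<rho>. length x = n \<Longrightarrow> length \<rho> = Suc m * (B * k) \<Longrightarrow>
      eval_circuit h (x @ \<rho>) = zl (lead (\<lambda>i. cnt (gain Ds zl x) (length Ds) i +
        (if i < Suc m then runs k B (take (B * k) (drop (i * (B * k)) \<rho>)) else 0)) m)"
proof -
  define K where "K = n + Suc m * (B * k)"
  let ?T = "length Ds"
  let ?in = "(\<lambda>j inp. inp ! j) ` {..<K} :: (bool list \<Rightarrow> bool) set"
  let ?c = "range (\<lambda>b _. b) :: (bool list \<Rightarrow> bool) set"
  let ?r = "\<lambda>i inp. runs k B (take (B * k) (drop (i * (B * k)) (drop n inp)))"
  let ?f = "\<lambda>t i inp. gain Ds zl (take n inp) t i"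
  let ?S = "\<lambda>i inp. cnt (\<lambda>t i. ?f t i inp) ?T i + ?r i inp"
  let ?R = "\<Union>i<Suc m. thr L (?r i)"
  let ?C = "\<Union>i<Suc m. thr L (?S i)"
  let ?out = "\<lambda>b inp. zl (lead (\<lambda>i. ?S i inp) m) ! b"
  have 1: "synth K ?in 2 ?c"
    using synth_image [of UNIV K ?in 1 "\<lambda>b _. b"] synth_const by simp
  have 2: "synth K (?in \<union> ?c) (Suc m * (2 + B * (k + 2))) ?R"
    using synth_UN [of "{..<Suc m}" K "?in \<union> ?c" "2 + B * (k + 2)" "\<lambda>i. thr L (?r i)"]
      synth_noise [of _ "Suc m" n B k] unfolding K_def by simp
  have 3: "synth K (?in \<union> (?c \<union> ?R)) (?T * (Suc m * (s + 1 + Suc L * 2))) ?C"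
  proof (rule synth_counters)
    fix t i assume t: "t < ?T" and i: "i < Suc m"
    have "distinguisher (n + l) s (fst (Ds ! t))"
      using Ds t by (metis nth_mem prod.collapse)
    then show "synth K (?in \<union> (?c \<union> ?R)) (s + 1) {?f t i}"
      by (rule synth_gain) (use zl i in \<open>auto simp: K_def\<close>)
  qed auto
  have 4: "synth K (?in \<union> (?c \<union> ?R \<union> ?C)) (l + m * (3 * L + 4 + l))
      (thr L (\<lambda>inp. ?S (lead (\<lambda>i. ?S i inp) m) inp) \<union> ?out ` {..<l})"
  proof (rule synth_lead)
    show "?S i inp \<le> L" for i inp
      unfolding L_def using cnt_le [of _ ?T i] runs_le by (metis add.commute add_mono)
  qed auto
  have 12: "synth K ?in (2 + Suc m * (2 + B * (k + 2))) (?c \<union> ?R)"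
    by (rule synth_trans [OF 1 2])
  have 123: "synth K ?in (2 + Suc m * (2 + B * (k + 2)) + ?T * (Suc m * (s + 1 + Suc L * 2)))
      (?c \<union> ?R \<union> ?C)"
    by (rule synth_trans [OF 12 3])
  have "synth K ?in (2 + Suc m * (2 + B * (k + 2)) + ?T * (Suc m * (s + 1 + Suc L * 2)) +
      (l + m * (3 * L + 4 + l))) (?out ` {..<l})"
    by (rule synth_mono [OF synth_trans [OF 123 4]]) auto
  then obtain h where h: "wf_circuit h K l"
    "circuit_size h \<le> 2 + Suc m * (2 + B * (k + 2)) +
      ?T * (Suc m * (s + 1 + Suc L * 2)) + (l + m * (3 * L + 4 + l))"
    "\<And>inp. length inp = K \<Longrightarrow> eval_circuit h inp = map (\<lambda>b. ?out b inp) [0..<l]"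
    by (rule circuit_of_synth) auto
  show thesis
  proof
    fix x \<rho> :: "bool list" assume len: "length x = n" "length \<rho> = Suc m * (B * k)"
    let ?i = "lead (\<lambda>i. ?S i (x @ \<rho>)) m"
    have "eval_circuit h (x @ \<rho>) = map (\<lambda>b. zl ?i ! b) [0..<l]"
      using h(3) [of "x @ \<rho>"] len by (simp add: K_def)
    also have "\<dots> = zl ?i"
      using zl [OF lead_le, of "\<lambda>i. ?S i (x @ \<rho>)"] map_nth [of "zl ?i"] by simp
    also have "?i = lead (\<lambda>i. cnt (gain Ds zl x) ?T i +
        (if i < Suc m then runs k B (take (B * k) (drop (i * (B * k)) \<rho>)) else 0)) m"
      by (rule lead_cong) (use len in simp)
    finally show "eval_circuit h (x @ \<rho>) = zl (lead (\<lambda>i. cnt (gain Ds zl x) ?T i +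
        (if i < Suc m then runs k B (take (B * k) (drop (i * (B * k)) \<rho>)) else 0)) m)" .
  qed (use h in \<open>auto simp: K_def\<close>)
qed

section \<open>Distinguishers as an adversary\<close>

lemma accept_prob_eq:
  "accept_prob D Y = measure_pmf.expectation Y (\<lambda>(x, z). of_bool (eval_circuit D (x @ z) = [True]))"
proof -
  have "(\<lambda>(x, z). of_bool (eval_circuit D (x @ z) = [True]) :: real) =
      indicator {(x, z). eval_circuit D (x @ z) = [True]}"
    by (auto simp: fun_eq_iff)
  then show ?thesis by (simp add: accept_prob_def)
qed

lemma map_noise_bits:
  "map_pmf (\<lambda>\<rho> i. if i < Suc m then runs k B (take (B * k) (drop (i * (B * k)) \<rho>)) else 0)
      (uniform_bits (Suc m * (B * k))) =
    noise (1 - 1 / 2 ^ k) B m"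
  unfolding map_blocks_uniform_bits map_runs_uniform_bits lessThan_Suc_atMost ..

section \<open>Choice of parameters\<close>

text \<open>From \<open>1 - x \<le> exp (- x)\<close> and \<open>exp 1 \<ge> 2\<close>.\<close>

lemma half_power:
  "(1 - 1 / 2 ^ k :: real) ^ (j * 2 ^ k) \<le> 1 / 2 ^ j"
proof -
  let ?p = "2 ^ k :: real"
  have "(1 - 1 / ?p) ^ (2 ^ k) \<le> exp (- (1 / ?p)) ^ (2 ^ k)"
    using exp_ge_add_one_self [of "- (1 / ?p)"] by (intro power_mono) auto
  also have "\<dots> = exp (- 1)"
    by (simp flip: exp_of_nat_mult)
  also have "\<dots> \<le> 1 / 2"
    using exp_ge_add_one_self [of 1] by (simp add: exp_minus field_simps)
  finally have "((1 - 1 / ?p) ^ (2 ^ k)) ^ j \<le> (1 / 2) ^ j"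
    by (intro power_mono) auto
  then show ?thesis
    by (simp add: power_divide mult.commute flip: power_mult)
qed

text \<open>Here \<open>q = 1 - 1 / 2 ^ k\<close>, \<open>M = l * 2 ^ k\<close>,
  \<open>B = (l + k) * 2 ^ k\<close> and \<open>T = (l + 1) * 4 ^ k\<close>. The initial noise costs
  at most \<open>(l + 1) * 2 ^ k = T / 2 ^ k\<close>, and each round at most
  \<open>2 / 2 ^ k\<close>.\<close>

lemma regret_bound:
  assumes "Suc m = 2 ^ l"
  shows "real (l * 2 ^ k) + real (Suc m) * ((1 - 1 / 2 ^ k) ^ (l * 2 ^ k) / (1 - (1 - 1 / 2 ^ k))) +
      real ((l + 1) * 4 ^ k) * ((1 - (1 - 1 / 2 ^ k)) + real (Suc m) * (1 - 1 / 2 ^ k) ^ ((l + k) * 2 ^ k))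
    \<le> real ((l + 1) * 4 ^ k) * (3 / 2 ^ k)"
proof -
  let ?p = "2 ^ k :: real" and ?q = "1 - 1 / 2 ^ k :: real"
  have N: "real (Suc m) = 2 ^ l" using assms by simp
  have "real (Suc m) * ?q ^ (l * 2 ^ k) \<le> 2 ^ l * (1 / 2 ^ l)"
    unfolding N by (intro mult_left_mono half_power) auto
  then have 1: "real (Suc m) * (?q ^ (l * 2 ^ k) / (1 - ?q)) \<le> ?p"
    using mult_right_mono [of "real (Suc m) * ?q ^ (l * 2 ^ k)" 1 ?p] by simp
  have "real (Suc m) * ?q ^ ((l + k) * 2 ^ k) \<le> 2 ^ l * (1 / 2 ^ (l + k))"
    unfolding N by (intro mult_left_mono half_power) auto
  then have 2: "real (Suc m) * ?q ^ ((l + k) * 2 ^ k) \<le> 1 / ?p"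
    by (simp add: power_add)
  have four: "(4 :: real) ^ k = ?p * ?p"
    by (simp flip: power_mult_distrib)
  have "real ((l + 1) * 4 ^ k) * ((1 - ?q) + real (Suc m) * ?q ^ ((l + k) * 2 ^ k)) \<le>
      real ((l + 1) * 4 ^ k) * (2 / ?p)"
    using 2 by (intro mult_left_mono) auto
  moreover have "real ((l + 1) * 4 ^ k) * (1 / ?p) = real (l * 2 ^ k) + ?p"
    by (simp add: four field_simps)
  ultimately show ?thesis
    using 1 by (simp add: algebra_simps)
qed

text \<open>The critical term is the counting, where the number of rounds times the counter length
  is of order \<open>(l + 1)^2 * (2 ^ k) ^ 4\<close>. Its factor \<open>(l + 1)^2\<close> is
  absorbed by \<open>3 * 2 ^ l\<close>.\<close>

lemma size_bound:
  fixes l k s m B t T L :: nat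
  assumes N: "Suc m = 2 ^ l" and s: "1 \<le> s" and B: "B = (l + k) * 2 ^ k"
    and T: "T = (l + 1) * 4 ^ k" and t: "t \<le> T" and L: "L = B + t"
  shows "2 + Suc m * (2 + B * (k + 2)) + t * (Suc m * (s + 1 + Suc L * 2)) + (l + m * (3 * L + 4 + l))
    \<le> 40 * (s * 2 ^ (2 * l) * (2 ^ k) ^ 4)"
proof -
  define a where "a = l + 1"
  define n where "n = (2 ^ l :: nat)"
  define p where "p = (2 ^ k :: nat)"
  define X where "X = s * (n * n) * (p * p * p * p)"
  have a: "a \<le> n" unfolding a_def n_def using Suc_leI [OF less_exp [of l]] by simp
  have aa: "a * a \<le> 3 * n"
  proof -
    have "(l + 1) * (l + 1) \<le> 3 * 2 ^ l" for l :: nat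
    proof (induction l)
      case (Suc l)
      show ?case
      proof (cases "l \<le> 2")
        case True
        then consider "l = 0" | "l = 1" | "l = 2" by linarith
        then show ?thesis by cases auto
      next
        case False
        then have "2 * l + 3 \<le> (l + 1) * (l + 1)"
          using mult_le_mono [of 2 l 2 l] by simp
        with Suc show ?thesis by simp
      qed
    qed simp
    then show ?thesis by (simp add: a_def n_def)
  qed
  have kp: "k + 1 \<le> p" unfolding p_def using Suc_leI [OF less_exp [of k]] by simp
  have pos: "1 \<le> a" "1 \<le> n" "1 \<le> p" by (auto simp: a_def n_def p_def)
  have four: "4 ^ k = p * p"
    by (simp add: p_def flip: power_mult_distrib)
  have Bp: "B \<le> a * (p * p)"
  proof -
    have "B \<le> (a * (k + 1)) * p" unfolding B p_def a_def by (intro mult_le_mono1) auto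
    also have "\<dots> \<le> (a * p) * p" using kp by (intro mult_le_mono1 mult_le_mono2)
    finally show ?thesis by (simp add: mult.assoc)
  qed
  have Tp: "t \<le> a * (p * p)" using t T four by (simp add: a_def)
  have Lp: "L \<le> 2 * (a * (p * p))" using L Bp Tp by simp
  have X: "u * v * w \<le> X" if "u \<le> s" "v \<le> n * n" "w \<le> p * p * p * p" for u v w
    unfolding X_def using that by (intro mult_le_mono)
  have nn: "n \<le> n * n" "1 \<le> n * n" using pos by auto
  have pp: "1 \<le> p * p * p * p" "p * p \<le> p * p * p * p" "p * p * p \<le> p * p * p * p"
    using pos by (auto simp: mult.assoc)
  have 1: "2 \<le> 2 * X" using X [of 1 1 1] s nn pp by simp
  have "Suc m * (2 + B * (k + 2)) \<le> n * (2 + (a * (p * p)) * (2 * p))"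
    unfolding N n_def [symmetric] using Bp kp pos by (intro mult_le_mono add_mono) auto
  also have "\<dots> \<le> n * (2 + (n * (p * p)) * (2 * p))"
    using a by (intro mult_le_mono add_mono) auto
  also have "\<dots> = 2 * (1 * n * 1) + 2 * (1 * (n * n) * (p * p * p))"
    by (simp add: algebra_simps)
  also have "\<dots> \<le> 2 * X + 2 * X"
    using X [of 1 n 1] X [of 1 "n * n" "p * p * p"] s nn pp by (intro add_mono mult_le_mono2) auto
  finally have 2: "Suc m * (2 + B * (k + 2)) \<le> 4 * X" by simp
  have "t * (Suc m * (s + 1 + Suc L * 2)) \<le> (a * (p * p)) * (n * (4 * s + 4 * (a * (p * p))))"
    unfolding N n_def [symmetric] using Tp Lp s by (intro mult_le_mono) auto
  also have "\<dots> = 4 * (s * (a * n) * (p * p)) + 4 * (1 * (a * a * n) * (p * p * p * p))"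
    by (simp add: algebra_simps)
  also have "\<dots> \<le> 4 * (s * (n * n) * (p * p)) + 4 * (1 * (3 * n * n) * (p * p * p * p))"
    using a aa by (intro add_mono mult_le_mono1 mult_le_mono2)
  also have "\<dots> \<le> 4 * X + 12 * X"
    using X [of s "n * n" "p * p"] X [of 1 "n * n" "p * p * p * p"] s pp
    by (intro add_mono) (auto simp: mult.assoc)
  finally have 3: "t * (Suc m * (s + 1 + Suc L * 2)) \<le> 16 * X" by simp
  have Ln: "L \<le> 2 * (n * (p * p))"
    using Lp a by (meson mult_le_mono1 mult_le_mono2 order_trans)
  have "l + m * (3 * L + 4 + l) \<le> n + n * (3 * (2 * (n * (p * p))) + 4 + n)"
    using Ln a N by (intro add_mono mult_le_mono) (auto simp: a_def n_def)
  also have "\<dots> = 5 * (1 * n * 1) + 6 * (1 * (n * n) * (p * p)) + 1 * (n * n) * 1"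
    by (simp add: algebra_simps)
  also have "\<dots> \<le> 5 * X + 6 * X + X"
    using X [of 1 n 1] X [of 1 "n * n" "p * p"] X [of 1 "n * n" 1] s nn pp
    by (intro add_mono mult_le_mono2) auto
  finally have 4: "l + m * (3 * L + 4 + l) \<le> 12 * X" by simp
  have "X = s * 2 ^ (2 * l) * (2 ^ k) ^ 4"
    by (simp add: X_def n_def p_def power4_eq_xxxx mult_2 power_add mult.assoc)
  \<comment> \<open>The coefficients add up to 2 + 4 + 16 + 12 = 34, which is below 40.\<close>
  with 1 2 3 4 show ?thesis by linarith
qed

section \<open>Collecting distinguishers against the leader\<close>

text \<open>Admitting negations removes the absolute value from \<open>indist\<close>: an advantage
  of either sign becomes a positive difference for one of the two flags.\<close>

definition signed_accept :: "circuit \<times> bool \<Rightarrow> (bool list \<times> bool list) pmf \<Rightarrow> real" where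
  "signed_accept e Y =
    measure_pmf.expectation Y (\<lambda>(x, z). of_bool ((eval_circuit (fst e) (x @ z) = [True]) = snd e))"

lemma signed_accept_True: "signed_accept (D, True) Y = accept_prob D Y"
  by (simp add: signed_accept_def accept_prob_eq)

lemma signed_accept_False:
  assumes "finite (set_pmf Y)"
  shows "signed_accept (D, False) Y = 1 - accept_prob D Y"
proof -
  have "signed_accept (D, False) Y =
      measure_pmf.expectation Y (\<lambda>y. 1 - (\<lambda>(x, z). of_bool (eval_circuit D (x @ z) = [True])) y)"
    unfolding signed_accept_def by (intro Bochner_Integration.integral_cong) auto
  also have "\<dots> = 1 - accept_prob D Y"
    unfolding accept_prob_eq
    by (subst Bochner_Integration.integral_diff) (auto intro: integrable_measure_pmf_finite assms)
  finally show ?thesis .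
qed

text \<open>The simulated pair as an abstract distribution, before any circuit. The round
  \<open>t\<close> is separate from the length of \<open>Ds\<close>, so that one final list
  describes the simulators of all rounds.\<close>

definition leader_joint ::
  "(nat \<Rightarrow> nat) pmf \<Rightarrow> nat \<Rightarrow> (nat \<Rightarrow> bool list) \<Rightarrow> (circuit \<times> bool) list \<Rightarrow> nat \<Rightarrow>
    (bool list \<times> bool list) pmf \<Rightarrow> (bool list \<times> bool list) pmf" where
  "leader_joint \<nu> m zl Ds t XZ = XZ \<bind> (\<lambda>(x, _).
     map_pmf (\<lambda>G. (x, zl (lead (\<lambda>i. cnt (gain Ds zl x) t i + G i) m))) \<nu>)"

text \<open>The simulator of round \<open>t\<close> looks only at the first \<open>t\<close>
  distinguishers, so adding new ones leaves the earlier simulators unchanged.\<close>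

lemma leader_joint_append:
  assumes "t \<le> length Ds"
  shows "leader_joint \<nu> m zl (Ds @ Es) t XZ = leader_joint \<nu> m zl Ds t XZ"
proof -
  have "cnt (gain (Ds @ Es) zl x) t i = cnt (gain Ds zl x) t i" for x i
    unfolding cnt_def using assms by (intro sum.cong) (auto simp: gain_def nth_append)
  then show ?thesis by (simp add: leader_joint_def)
qed

lemma signed_accept_leader_joint:
  assumes "finite (set_pmf XZ)" "finite (set_pmf \<nu>)"
  shows "signed_accept (Ds ! t) (leader_joint \<nu> m zl Ds t XZ) =
    measure_pmf.expectation XZ (\<lambda>(x, _). measure_pmf.expectation \<nu>
      (\<lambda>G. of_bool (gain Ds zl x t (lead (\<lambda>i. cnt (gain Ds zl x) t i + G i) m))))"
proof -
  have "signed_accept (Ds ! t) (leader_joint \<nu> m zl Ds t XZ) =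
    measure_pmf.expectation XZ (\<lambda>xz. measure_pmf.expectation
      (case xz of (x, _) \<Rightarrow> map_pmf (\<lambda>G. (x, zl (lead (\<lambda>i. cnt (gain Ds zl x) t i + G i) m))) \<nu>)
      (\<lambda>(x, z). of_bool ((eval_circuit (fst (Ds ! t)) (x @ z) = [True]) = snd (Ds ! t))))"
    unfolding signed_accept_def leader_joint_def
    by (rule expectation_bind_finite) (use assms in auto)
  also have "\<dots> = measure_pmf.expectation XZ (\<lambda>(x, _). measure_pmf.expectation \<nu>
      (\<lambda>G. of_bool (gain Ds zl x t (lead (\<lambda>i. cnt (gain Ds zl x) t i + G i) m))))"
    by (intro Bochner_Integration.integral_cong) (auto simp: gain_def)
  finally show ?thesis .
qed

text \<open>For each fixed \<open>(x, z)\<close> the comparator is the index of \<open>z\<close>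
  itself, so its total gain counts the acceptances of the true pair. Averaging the regret bound over
  \<open>XZ\<close> gives the claim.\<close>

lemma leader_joint_regret:
  assumes fin: "finite (set_pmf XZ)" and zl: "snd ` set_pmf XZ \<subseteq> zl ` {..m}"
    and q: "0 \<le> q" "q < 1"
  shows "(\<Sum>t<T. signed_accept (Ds ! t) XZ) \<le>
    (\<Sum>t<T. signed_accept (Ds ! t) (leader_joint (noise q B m) m zl Ds t XZ)) +
    (real M + real (Suc m) * (q ^ M / (1 - q)) + real T * ((1 - q) + real (Suc m) * q ^ B))"
    (is "_ \<le> _ + ?R")
proof -
  let ?E = "measure_pmf.expectation XZ"
  let ?p = "\<lambda>t x. measure_pmf.expectation (noise q B m)
      (\<lambda>G. of_bool (gain Ds zl x t (lead (\<lambda>i. cnt (gain Ds zl x) t i + G i) m))) :: real"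
  let ?acc = "\<lambda>t (x, z).
      of_bool ((eval_circuit (fst (Ds ! t)) (x @ z) = [True]) = snd (Ds ! t)) :: real"
  have int: "integrable (measure_pmf XZ) (h :: _ \<Rightarrow> real)" for h
    using fin by (rule integrable_measure_pmf_finite)
  have "(\<Sum>t<T. signed_accept (Ds ! t) XZ) =
      ?E (\<lambda>y. \<Sum>t<T. ?acc t y)"
    unfolding signed_accept_def by (rule Bochner_Integration.integral_sum [symmetric]) (rule int)
  also have "\<dots> \<le> ?E (\<lambda>y. (\<Sum>t<T. (\<lambda>(x, _). ?p t x) y) + ?R)"
  proof (rule expectation_mono_finite [OF fin])
    fix y assume "y \<in> set_pmf XZ"
    with zl have "snd y \<in> zl ` {..m}" by blast
    then obtain x i where y: "y = (x, zl i)" and i: "i \<le> m" by (cases y) auto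
    have "(\<Sum>t<T. ?acc t y) = real (cnt (gain Ds zl x) T i)"
      unfolding cnt_def y of_nat_sum by (intro sum.cong) (auto simp: gain_def)
    also have "\<dots> \<le> (\<Sum>t<T. ?p t x) + ?R"
      using perturbed_leader_regret [OF q i, of "gain Ds zl x" T B M] by (simp only: add.assoc)
    finally show "(\<Sum>t<T. ?acc t y) \<le> (\<Sum>t<T. (\<lambda>(x, _). ?p t x) y) + ?R"
      by (simp only: y prod.case)
  qed
  also have "\<dots> = (\<Sum>t<T. ?E (\<lambda>(x, _). ?p t x)) + ?R"
    by (simp add: Bochner_Integration.integral_add Bochner_Integration.integral_sum int)
  finally show ?thesis by (simp add: signed_accept_leader_joint fin)
qed

lemma leader_joint_simulator:
  fixes B :: nat and Ds :: "(circuit \<times> bool) list"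
  assumes Ds: "\<And>D \<sigma>. (D, \<sigma>) \<in> set Ds \<Longrightarrow> distinguisher (n + l) s D"
    and zl: "\<And>i. i \<le> m \<Longrightarrow> length (zl i) = l"
    and XZ: "\<And>x z. (x, z) \<in> set_pmf XZ \<Longrightarrow> length x = n"
  defines "L \<equiv> B + length Ds"
  obtains h r where "wf_circuit h (n + r) l"
    "circuit_size h \<le> 2 + Suc m * (2 + B * (k + 2)) +
      length Ds * (Suc m * (s + 1 + Suc L * 2)) + (l + m * (3 * L + 4 + l))"
    "sim_joint h r XZ = leader_joint (noise (1 - 1 / 2 ^ k) B m) m zl Ds (length Ds) XZ"
proof -
  obtain h where h: "wf_circuit h (n + Suc m * (B * k)) l"
    "circuit_size h \<le> 2 + Suc m * (2 + B * (k + 2)) +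
      length Ds * (Suc m * (s + 1 + Suc L * 2)) + (l + m * (3 * L + 4 + l))"
    "\<And>x \<rho>. length x = n \<Longrightarrow> length \<rho> = Suc m * (B * k) \<Longrightarrow>
      eval_circuit h (x @ \<rho>) = zl (lead (\<lambda>i. cnt (gain Ds zl x) (length Ds) i +
        (if i < Suc m then runs k B (take (B * k) (drop (i * (B * k)) \<rho>)) else 0)) m)"
    by (rule perturbed_leader_circuit [where Ds = Ds and n = n and l = l and s = s and m = m
          and zl = zl and B = B and k = k, folded L_def]) (use Ds zl in auto)
  let ?r = "Suc m * (B * k)"
  have rand: "rand_eval h ?r x =
      map_pmf (\<lambda>G. zl (lead (\<lambda>i. cnt (gain Ds zl x) (length Ds) i + G i) m))
      (noise (1 - 1 / 2 ^ k) B m)" if "length x = n" for x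
    unfolding rand_eval_def map_noise_bits [symmetric] map_pmf_comp
    by (rule map_pmf_cong [OF refl], rule h(3) [OF that]) simp
  have "sim_joint h ?r XZ = leader_joint (noise (1 - 1 / 2 ^ k) B m) m zl Ds (length Ds) XZ"
    unfolding sim_joint_def leader_joint_def
    by (rule bind_pmf_cong [OF refl]) (use XZ in \<open>auto simp: rand map_pmf_comp simp del: mult_Suc\<close>)
  with h(1,2) that show thesis by blast
qed

text \<open>If every circuit within the size bound failed, each leader would yield a further
  distinguisher of advantage above \<open>\<epsilon>\<close>. After \<open>T\<close> rounds their
  total exceeds \<open>T * \<epsilon>\<close>, while the regret is at most
  \<open>T * (3 / 2 ^ k) \<le> T * \<epsilon>\<close>.\<close>

lemma simulator_exists:
  assumes XZ: "set_pmf XZ \<subseteq> {(x, z). length x = n \<and> length z = l}"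
    and s: "1 \<le> s" and eps: "3 \<le> \<epsilon> * 2 ^ k"
  obtains h r where "wf_circuit h (n + r) l" "indist n l s \<epsilon> (sim_joint h r XZ) XZ"
    "circuit_size h \<le> 40 * (s * 2 ^ (2 * l) * (2 ^ k) ^ 4)"
proof (rule ccontr)
  note result = that
  assume neg: "\<not> thesis"
  define m where "m = (2 ^ l - 1 :: nat)"
  have m: "Suc m = 2 ^ l" by (simp add: m_def)
  define B where "B = (l + k) * 2 ^ k"
  define T where "T = (l + 1) * 4 ^ k"
  define q :: real where "q = 1 - 1 / 2 ^ k"
  have q: "0 \<le> q" "q < 1" by (auto simp: q_def)
  have "{(x, z). length x = n \<and> length z = l} =
      {x :: bool list. length x = n} \<times> {z :: bool list. length z = l}"
    by auto
  then have fin: "finite (set_pmf XZ)"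
    using finite_subset [OF XZ] by simp
  \<comment> \<open>The candidates are all \<open>2 ^ l\<close> strings, so the true
    \<open>z\<close> is always among the comparators.\<close>
  obtain zl where "bij_betw zl {0..<card {z :: bool list. length z = l}} {z :: bool list. length z = l}"
    using ex_bij_betw_nat_finite [OF finite_length_eq] by blast
  then have zl_image: "zl ` {..m} = {z. length z = l}"
    unfolding card_length_eq m [symmetric] bij_betw_def
    by (simp add: atLeast0LessThan lessThan_Suc_atMost)
  define sim where "sim = (\<lambda>Ds t. leader_joint (noise q B m) m zl Ds t XZ)"
  have fin_sim: "finite (set_pmf (sim Ds t))" for Ds t
    using fin by (auto simp: sim_def leader_joint_def)
  have step: "\<exists>D \<sigma>. distinguisher (n + l) s D \<and>
      \<epsilon> < signed_accept (D, \<sigma>) XZ - signed_accept (D, \<sigma>) (sim Ds (length Ds))"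
    if Ds: "\<And>D \<sigma>. (D, \<sigma>) \<in> set Ds \<Longrightarrow> distinguisher (n + l) s D" and len: "length Ds \<le> T" for Ds
  proof -
    obtain h r where h: "wf_circuit h (n + r) l"
      "circuit_size h \<le> 2 + Suc m * (2 + B * (k + 2)) +
        length Ds * (Suc m * (s + 1 + Suc (B + length Ds) * 2)) + (l + m * (3 * (B + length Ds) + 4 + l))"
      "sim_joint h r XZ = sim Ds (length Ds)"
    proof (rule leader_joint_simulator [of Ds n l s m zl XZ B k])
      show "length (zl i) = l" if "i \<le> m" for i using zl_image that by blast
      show "length x = n" if "(x, z) \<in> set_pmf XZ" for x z using that XZ by auto
    qed (use Ds in \<open>auto simp: sim_def q_def\<close>)
    have "circuit_size h \<le> 40 * (s * 2 ^ (2 * l) * (2 ^ k) ^ 4)"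
      using h(2) size_bound [OF m s B_def T_def len refl] by (rule order_trans)
    then have "\<not> indist n l s \<epsilon> (sim_joint h r XZ) XZ"
      using neg result h(1) by blast
    then obtain D where D: "distinguisher (n + l) s D"
      "\<epsilon> < \<bar>accept_prob D (sim Ds (length Ds)) - accept_prob D XZ\<bar>"
      by (auto simp: indist_def distinguisher_def h(3) not_le)
    then have "\<epsilon> < signed_accept (D, True) XZ - signed_accept (D, True) (sim Ds (length Ds)) \<or>
        \<epsilon> < signed_accept (D, False) XZ - signed_accept (D, False) (sim Ds (length Ds))"
      by (auto simp: signed_accept_True signed_accept_False fin fin_sim)
    with D(1) show ?thesis by blast
  qed
  \<comment> \<open>The list is grown greedily, each entry beating the leader built from the entries
    before it.\<close>
  have "\<exists>Ds. length Ds = t \<and> (\<forall>(D, \<sigma>) \<in> set Ds. distinguisher (n + l) s D) \<and>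
      (\<forall>\<tau><t. \<epsilon> < signed_accept (Ds ! \<tau>) XZ - signed_accept (Ds ! \<tau>) (sim Ds \<tau>))" if "t \<le> T" for t
    using that
  proof (induction t)
    case (Suc t)
    then obtain Ds where Ds: "length Ds = t" "\<forall>(D, \<sigma>) \<in> set Ds. distinguisher (n + l) s D"
      "\<And>\<tau>. \<tau> < t \<Longrightarrow> \<epsilon> < signed_accept (Ds ! \<tau>) XZ - signed_accept (Ds ! \<tau>) (sim Ds \<tau>)"
      by auto
    have "distinguisher (n + l) s D" if "(D, \<sigma>) \<in> set Ds" for D \<sigma>
      using Ds(2) that by blast
    then obtain D \<sigma> where D: "distinguisher (n + l) s D"
      "\<epsilon> < signed_accept (D, \<sigma>) XZ - signed_accept (D, \<sigma>) (sim Ds t)"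
      using step [of Ds] Ds(1) Suc.prems by auto
    have app: "sim (Ds @ [(D, \<sigma>)]) \<tau> = sim Ds \<tau>" if "\<tau> \<le> t" for \<tau>
      using that Ds(1) by (simp add: sim_def leader_joint_append)
    have "\<epsilon> < signed_accept ((Ds @ [(D, \<sigma>)]) ! \<tau>) XZ -
        signed_accept ((Ds @ [(D, \<sigma>)]) ! \<tau>) (sim (Ds @ [(D, \<sigma>)]) \<tau>)" if "\<tau> < Suc t" for \<tau>
    proof (cases "\<tau> = t")
      case True
      then show ?thesis using D(2) Ds(1) app [of t] by (simp add: nth_append)
    next
      case False
      then show ?thesis using Ds(3) [of \<tau>] Ds(1) app [of \<tau>] that by (simp add: nth_append)
    qed
    then show ?case
      using Ds D(1) by (intro exI [of _ "Ds @ [(D, \<sigma>)]"]) auto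
  qed simp
  from this [OF order_refl] obtain Ds where
    Ds: "\<And>\<tau>. \<tau> < T \<Longrightarrow> \<epsilon> < signed_accept (Ds ! \<tau>) XZ - signed_accept (Ds ! \<tau>) (sim Ds \<tau>)"
    by auto
  have T: "0 < T" by (simp add: T_def)
  have snd_XZ: "snd ` set_pmf XZ \<subseteq> zl ` {..m}"
    unfolding zl_image using XZ by auto
  have "(\<Sum>t<T. \<epsilon>) < (\<Sum>t<T. signed_accept (Ds ! t) XZ - signed_accept (Ds ! t) (sim Ds t))"
    by (rule sum_strict_mono) (use T Ds in auto)
  also have "\<dots> \<le> real (l * 2 ^ k) + real (Suc m) * (q ^ (l * 2 ^ k) / (1 - q)) +
      real T * ((1 - q) + real (Suc m) * q ^ B)"
    using leader_joint_regret [OF fin snd_XZ q, of Ds T B "l * 2 ^ k"]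
    unfolding sum_subtractf sim_def by linarith
  also have "\<dots> \<le> real T * (3 / 2 ^ k)"
    unfolding q_def B_def T_def by (rule regret_bound [OF m])
  also have "\<dots> \<le> real T * \<epsilon>"
    using eps by (intro mult_left_mono) (auto simp: field_simps)
  finally show False by simp
qed

text \<open>For large \<open>\<epsilon>\<close> the size bound falls below 1 and leaves no room for
  a gate. The extra input, a random bit, ensures that wire 0 exists even for
  \<open>n = 0\<close>.\<close>

lemma gate_free_circuit:
  "wf_circuit (Circuit (n + 1) [] (replicate l 0)) (n + 1) l"
  by (auto simp: wf_circuit_def)

lemma indist_ge_1:
  assumes "1 \<le> \<epsilon>"
  shows "indist n l s \<epsilon> Y1 Y2"
proof -
  have "\<bar>accept_prob D Y1 - accept_prob D Y2\<bar> \<le> \<epsilon>" for D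
    using assms measure_pmf.prob_le_1 [of Y1] measure_pmf.prob_le_1 [of Y2]
      measure_nonneg [of Y1] measure_nonneg [of Y2]
    unfolding accept_prob_def by (smt (verit))
  then show ?thesis by (simp add: indist_def)
qed

theorem theorem3:
  shows "\<exists>K::real. K > 0 \<and>
    (\<forall>(n::nat) (l::nat) (XZ :: (bool list \<times> bool list) pmf) (\<epsilon>::real) (s::nat).
       set_pmf XZ \<subseteq> {(x, z). length x = n \<and> length z = l} \<and> \<epsilon> > 0 \<and> s \<ge> 1 \<longrightarrow>
       (\<exists>h r. wf_circuit h (n + r) l \<and>
              indist n l s \<epsilon> (sim_joint h r XZ) XZ \<and>
              real (circuit_size h) \<le> K * real s * 2 ^ (2 * l) / \<epsilon> ^ 4))"
\<comment> \<open>The constant is \<open>40 * 6 ^ 4\<close>: 40 from the size of the simulator, and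
  6 from the bound on \<open>\<epsilon> * 2 ^ k\<close>.\<close>
proof (intro exI [of _ "51840 :: real"] conjI allI impI)
  fix n l :: nat and XZ :: "(bool list \<times> bool list) pmf" and \<epsilon> :: real and s :: nat
  assume asm: "set_pmf XZ \<subseteq> {(x, z). length x = n \<and> length z = l} \<and> \<epsilon> > 0 \<and> s \<ge> 1"
  show "\<exists>h r. wf_circuit h (n + r) l \<and> indist n l s \<epsilon> (sim_joint h r XZ) XZ \<and>
      real (circuit_size h) \<le> 51840 * real s * 2 ^ (2 * l) / \<epsilon> ^ 4"
  proof (cases "1 \<le> \<epsilon>")
    case True
    then show ?thesis
      using gate_free_circuit [of n l] indist_ge_1 [OF True] asm
      by (intro exI [of _ "Circuit (n + 1) [] (replicate l 0)"] exI [of _ 1])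
        (simp add: circuit_size_def)
  next
    case False
    define k where "k = (LEAST k. 3 \<le> \<epsilon> * 2 ^ k)"
    obtain j where "3 / \<epsilon> < 2 ^ j" using real_arch_pow [of 2 "3 / \<epsilon>"] by auto
    then have "3 \<le> \<epsilon> * 2 ^ j" using asm by (simp add: field_simps)
    then have k: "3 \<le> \<epsilon> * 2 ^ k" unfolding k_def by (rule LeastI)
    \<comment> \<open>Minimality of \<open>k\<close> gives
      \<open>\<epsilon> * 2 ^ (k - 1) < 3\<close> for positive \<open>k\<close>; the case
      \<open>k = 0\<close> is settled by \<open>\<epsilon> < 1\<close>.\<close>
    have upper: "\<epsilon> * 2 ^ k \<le> 6"
    proof (cases k)
      case 0
      then show ?thesis using k False by simp
    next
      case (Suc k')
      then have "\<not> 3 \<le> \<epsilon> * 2 ^ k'" unfolding k_def by (intro not_less_Least) simp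
      with Suc show ?thesis by simp
    qed
    obtain h r where h: "wf_circuit h (n + r) l" "indist n l s \<epsilon> (sim_joint h r XZ) XZ"
      "circuit_size h \<le> 40 * (s * 2 ^ (2 * l) * (2 ^ k) ^ 4)"
      using simulator_exists [OF _ _ k] asm by blast
    have "real (circuit_size h) \<le> 40 * (real s * 2 ^ (2 * l) * (2 ^ k) ^ 4)"
      using of_nat_mono [OF h(3), where 'a = real] by simp
    also have "\<dots> = 40 * real s * 2 ^ (2 * l) * (\<epsilon> * 2 ^ k) ^ 4 / \<epsilon> ^ 4"
      using asm by (simp add: power_mult_distrib)
    also have "\<dots> \<le> 40 * real s * 2 ^ (2 * l) * 6 ^ 4 / \<epsilon> ^ 4"
      using asm upper by (intro divide_right_mono mult_left_mono power_mono) auto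
    finally have "real (circuit_size h) \<le> 51840 * real s * 2 ^ (2 * l) / \<epsilon> ^ 4"
      by simp
    with h show ?thesis by blast
  qed
qed simp

end
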